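(* Let $d\ge 5$ be an integer and let $p>\frac{2d}{d-4}$. Then there is a constant $C=C(d,p)$ such that for every $N>0$ with $N^2\in\mathbb{Z}$, and every eigenfunction $e_N$ of $\sqrt{-\Delta}$ on $\mathbb{T}^d=\mathbb{R}^d/\mathbb{Z}^d$ with eigenvalue $2\pi N$, that is, every function of the form $$e_N(x)=\sum_{\mathbf{k}\in\mathbb{Z}^d,\ |\mathbf{k}|=N}a_{\mathbf{k}}\,e^{2\pi i\mathbf{k}\cdot x},\qquad a_{\mathbf{k}}\in\mathbb{C},$$ one has $$\|e_N\|_{L^p(\mathbb{T}^d)}\le C\,N^{\frac{d-2}{2}-\frac{d}{p}}\,\|e_N\|_{L^2(\mathbb{T}^d)}.$$
   Context: $\mathbb{T}^d=\mathbb{R}^d/\mathbb{Z}^d$ is the square torus, identified with $[0,1]^d$ with Lebesgue measure; $|\mathbf{k}|$ is the Euclidean norm. The constant may depend on $d$ and $p$ but not on $N$ or on the eigenfunction. *)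

theory Defs
  imports "HOL-Analysis.Analysis"
begin

definition lattice_sphere :: "real \<Rightarrow> (real ^ 'd) set" where
  "lattice_sphere N = {k. (\<forall>i. k $ i \<in> \<int>) \<and> norm k = N}"

text \<open>
  The sum in the next definition ranges over a finite set, so the convention that sums over
  infinite sets are zero plays no role.
\<close>

lemma finite_lattice_sphere: "finite (lattice_sphere N :: (real ^ 'd) set)"
proof -
  define S where "S = {z::real. z \<in> \<int> \<and> \<bar>z\<bar> \<le> N}"
  have "finite S"
    unfolding S_def by (rule finite_abs_int_segment)
  then have "finite {f :: 'd \<Rightarrow> real. \<forall>i. f i \<in> S}"
    using finite_PiE[of "UNIV :: 'd set" "\<lambda>_. S"] by (simp add: PiE_UNIV_domain Pi_def)
  then have "finite (vec_lambda ` {f :: 'd \<Rightarrow> real. \<forall>i. f i \<in> S})"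
    by (rule finite_imageI)
  moreover have "lattice_sphere N \<subseteq> vec_lambda ` {f :: 'd \<Rightarrow> real. \<forall>i. f i \<in> S}"
  proof
    fix k :: "real ^ 'd"
    assume k: "k \<in> lattice_sphere N"
    then have "\<forall>i. k $ i \<in> S"
      using component_le_norm_cart[of k] by (auto simp: lattice_sphere_def S_def)
    then show "k \<in> vec_lambda ` {f :: 'd \<Rightarrow> real. \<forall>i. f i \<in> S}"
      by (intro image_eqI[of _ _ "vec_nth k"]) auto
  qed
  ultimately show ?thesis
    by (rule rev_finite_subset)
qed

text \<open>
  Functions on the torus are represented by their periodic lifts to \<open>\<real>\<^sup>d\<close>. The zero function
  counts as an eigenfunction here.
\<close>

definition torus_eigenfunction :: "real \<Rightarrow> (real ^ 'd \<Rightarrow> complex) \<Rightarrow> bool" where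
  "torus_eigenfunction N f \<longleftrightarrow>
     (\<exists>a :: real ^ 'd \<Rightarrow> complex.
        f = (\<lambda>x. \<Sum>k\<in>lattice_sphere N. a k * exp (2 * of_real pi * \<i> * of_real (k \<bullet> x))))"

text \<open>
  The torus is identified with the unit cube; the norm is meaningful for \<open>0 < p < \<infinity>\<close> and
  \<open>\<bar>f\<bar>\<^sup>p\<close> integrable, which holds for every (continuous) eigenfunction.
\<close>

definition torus_Lp_norm :: "real \<Rightarrow> (real ^ 'd \<Rightarrow> complex) \<Rightarrow> real" where
  "torus_Lp_norm p f = (LINT x:cbox 0 1|lborel. norm (f x) powr p) powr (1 / p)"

end

theory Submission
  imports Defs
begin

text \<open>
  The proof is the Stein-Tomas argument on level sets, with the sphere resolved by the circle method.
  Let \<open>f\<close> be an eigenfunction with \<open>\<parallel>f\<parallel>\<^sub>2 = 1\<close>, let \<open>E\<close> be the set where \<open>\<bar>f\<bar> > l\<close>, and let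
  \<open>g\<close> be the phase of \<open>f\<close> on \<open>E\<close> and zero elsewhere. Pairing \<open>f\<close> with \<open>g\<close> shows that
  \<open>l\<^sup>2\<bar>E\<bar>\<^sup>2\<close> is at most the sum of \<open>\<bar>c k\<bar>\<^sup>2\<close> over the frequencies \<open>k\<close> of length \<open>N\<close>, where
  \<open>c k\<close> are the Fourier coefficients of \<open>g\<close>. Since \<open>\<bar>k\<bar>\<^sup>2 - N\<^sup>2\<close> is an integer, this sum is the
  integral over \<open>0 \<le> t \<le> 1\<close> of \<open>T t\<close> times a unimodular factor, where \<open>T t\<close> is the sum of
  \<open>\<bar>c k\<bar>\<^sup>2 * cis (2\<pi>t\<bar>k\<bar>\<^sup>2)\<close> over all lattice points \<open>k\<close> of a box of side length about \<open>2N\<close>.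

  For each \<open>t\<close> there are two bounds. Bessel's inequality gives \<open>\<bar>T t\<bar> \<le> \<bar>E\<bar>\<close>. Undoing the Fourier
  transform gives \<open>\<bar>T t\<bar> \<le> \<bar>E\<bar>\<^sup>2\<close> times the supremum of the kernel
  \<open>\<Sum>k. cis (2\<pi>(k \<bullet> z + t\<bar>k\<bar>\<^sup>2))\<close>, which is a product of \<open>d\<close> one-dimensional Weyl sums. The
  weighted geometric mean of the two bounds is \<open>\<bar>E\<bar> powr (1 + \<sigma>)\<close> times the power \<open>\<sigma>\<close> of the
  supremum, so everything depends on the moment of order \<open>s = d * \<sigma>\<close> of the supremum of a Weyl
  sum over its linear phase (\<open>weyl_sum_maximal_moment\<close>).

  At \<open>t = a/q + b\<close> a Weyl sum of length \<open>N\<close> has size \<open>N\<close> over the square root of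
  \<open>D = q * (1 + N\<^sup>2\<bar>b\<bar>)\<close>, up to an arbitrarily small power of \<open>D\<close> and uniformly in the linear phase;
  this follows from Weyl differencing and Dirichlet's approximation theorem
  (\<open>weyl_sum_bound\<close>). Integrating in \<open>b\<close> and summing over the at most \<open>q + 1\<close> numerators leaves
  \<open>N powr (s - 2)\<close> times the series of \<open>q powr (1 - s/2)\<close>, up to the small loss in the exponent. It
  converges for \<open>s > 4\<close>, that is, for \<open>\<sigma> > 4/d\<close>.

  The result is \<open>l\<^sup>2 * \<bar>E\<bar> powr (1 - \<sigma>) \<le> C * N powr (d * \<sigma> - 2)\<close> (\<open>level_set_bound\<close>), a weak-type
  bound with exponent \<open>2/(1 - \<sigma>)\<close>. A \<open>\<sigma> > 4/d\<close> for which this exponent is smaller than \<open>p\<close> exists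
  exactly if \<open>p > 2d/(d - 4)\<close>. The endpoint \<open>\<sigma> = 1\<close> bounds the number of lattice points on the
  sphere by a multiple of \<open>N powr (d - 2)\<close>, and with it the maximum of \<open>f\<close>
  (\<open>card_lattice_sphere_bound\<close>). Summing the level sets over the dyadic heights below this maximum
  turns the weak-type bound into the strong one for \<open>p\<close>.
\<close>

section \<open>Geometric sums and Weyl differencing\<close>

definition int_dist :: "real \<Rightarrow> real" where
  "int_dist x = \<bar>x - of_int (round x)\<bar>"

lemma int_dist_le_half: "int_dist x \<le> 1/2"
  using of_int_round_abs_le[of x] by (simp add: int_dist_def abs_minus_commute)

lemma int_dist_le: "int_dist x \<le> \<bar>x - of_int m\<bar>"
  unfolding int_dist_def by (rule round_diff_minimal)

lemma int_dist_triangle: "int_dist y \<le> int_dist x + \<bar>x - y\<bar>"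
  using int_dist_le[of y "round x"] by (simp add: int_dist_def)

text \<open>
  The slope \<open>1/\<pi>\<close> is below the optimal \<open>2/\<pi>\<close>, which leaves room for a short proof: up to
  \<open>\<pi>/3\<close> the cosine is at least \<open>1/2\<close>, and beyond it the sine is at least \<open>1/2\<close>.
\<close>

lemma sin_ge_divide_pi:
  assumes "0 \<le> y" "y \<le> pi / 2"
  shows "y / pi \<le> sin y"
proof (cases "y \<le> pi / 3")
  case True
  have "\<exists>z\<ge>0. z \<le> y \<and> sin y = y * cos z"
  proof (cases "y = 0")
    case False
    then obtain z where "0 < z" "z < y" "sin y - sin 0 = (y - 0) * cos z"
      using MVT2[of 0 y sin cos] assms(1) DERIV_sin by (metis order_le_less)
    then show ?thesis by (intro exI[of _ z]) auto
  qed auto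
  then obtain z where z: "0 \<le> z" "z \<le> y" "sin y = y * cos z" by blast
  have "cos (pi/3) \<le> cos z"
    using z True pi_gt_zero by (intro cos_monotone_0_pi_le) auto
  then have "1/2 \<le> cos z" by (simp add: cos_60)
  then have "y * (1/2) \<le> sin y" using z(3) assms by (metis mult_left_mono)
  moreover have "y / pi \<le> y * (1/2)"
    using mult_right_mono[OF pi_ge_two assms(1)] by (simp add: field_simps)
  ultimately show ?thesis by linarith
next
  case False
  have "sin (pi/6) \<le> sin y"
    using False assms by (intro sin_monotone_2pi_le) auto
  moreover have "y / pi \<le> 1/2" using assms by (simp add: field_simps)
  ultimately show ?thesis using sin_30 by linarith
qed

lemma int_dist_le_norm_one_minus_cis: "2 * int_dist x \<le> norm (1 - cis (2 * pi * x))"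
proof -
  define d where "d = x - of_int (round x)"
  have "cis (2 * pi * x) = cis (2 * pi * d) * cis (2 * pi * of_int (round x))"
    by (simp add: cis_mult d_def algebra_simps)
  also have "cis (2 * pi * of_int (round x)) = 1"
    by (rule cis_multiple_2pi) simp
  finally have "norm (1 - cis (2 * pi * x)) = norm (1 - cis (2 * pi * d))" by simp
  moreover have sq: "(norm (1 - cis (2 * pi * d)))\<^sup>2 = (2 * sin (pi * \<bar>d\<bar>))\<^sup>2"
  proof -
    have "(norm (1 - cis (2 * pi * d)))\<^sup>2 = (1 - cos (2*(pi*d)))\<^sup>2 + (sin (2*(pi*d)))\<^sup>2"
      unfolding cmod_power2 by (simp add: mult.assoc del: cos_double sin_double)
    also have "\<dots> = 2 - 2 * cos (2*(pi*d))"
      using sin_cos_squared_add[of "2*(pi*d)"] by (simp add: power2_eq_square algebra_simps)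
    also have "\<dots> = 4 * (sin (pi * d))\<^sup>2"
      by (simp add: cos_double_sin)
    finally show ?thesis by (cases "d \<ge> 0") (auto simp: power_mult_distrib)
  qed
  moreover have "int_dist x = \<bar>d\<bar>" by (simp add: int_dist_def d_def)
  moreover have ge: "\<bar>d\<bar> \<le> sin (pi * \<bar>d\<bar>)"
    using sin_ge_divide_pi[of "pi * \<bar>d\<bar>"] int_dist_le_half[of x] \<open>int_dist x = \<bar>d\<bar>\<close> by simp
  moreover have "norm (1 - cis (2 * pi * d)) = 2 * sin (pi * \<bar>d\<bar>)"
  proof (rule power2_eq_imp_eq[OF sq norm_ge_zero])
    show "0 \<le> 2 * sin (pi * \<bar>d\<bar>)" using ge abs_ge_zero[of d] by linarith
  qed
  ultimately show ?thesis by simp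
qed

text \<open>
  The usual majorant \<open>min (2M + 1) (1/\<parallel>x\<parallel>)\<close> of a geometric sum of at most \<open>2M + 1\<close> unimodular
  terms, where \<open>\<parallel>x\<parallel>\<close> is the distance to the nearest integer. Writing it with a maximum in the
  denominator gives the right value \<open>2M + 1\<close> also at integers \<open>x\<close>, where \<open>1/0 = 0\<close> would not.
\<close>

definition peak :: "nat \<Rightarrow> real \<Rightarrow> real" where
  "peak M x = 1 / max (1 / (2 * real M + 1)) (int_dist x)"

lemma peak_nonneg: "0 \<le> peak M x"
  by (simp add: peak_def le_max_iff_disj)

lemma peak_le: "peak M x \<le> 2 * real M + 1"
proof -
  have "1 / max (1 / (2 * real M + 1)) (int_dist x) \<le> 1 / (1 / (2 * real M + 1))"
    by (intro divide_left_mono) (auto simp: less_max_iff_disj)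
  then show ?thesis by (simp add: peak_def)
qed

lemma peak_le_inverse: "0 < int_dist x \<Longrightarrow> peak M x \<le> 1 / int_dist x"
  unfolding peak_def by (intro divide_left_mono) (auto simp: less_max_iff_disj)

lemma norm_sum_cis_interval_le_peak:
  fixes u v :: int
  assumes "- int M \<le> u" "v \<le> int M"
  shows "norm (\<Sum>n=u..v. cis (2 * pi * (of_int n * x))) \<le> peak M x"
proof -
  let ?S = "\<Sum>n=u..v. cis (2 * pi * (of_int n * x))"
  define z where "z = cis (2 * pi * x)"
  have "norm ?S \<le> (\<Sum>n=u..v. 1)"
    by (rule sum_norm_le) simp
  also have "\<dots> \<le> 2 * real M + 1" using assms by simp
  finally have triv: "norm ?S \<le> 2 * real M + 1" .
  have "?S = (\<Sum>m<nat (v - u + 1). cis (2 * pi * (of_int u * x)) * z ^ m)"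
    by (rule sum.reindex_bij_witness[of _ "\<lambda>m. u + int m" "\<lambda>n. nat (n - u)"])
       (auto simp: z_def Complex.DeMoivre cis_mult algebra_simps)
  also have "\<dots> = cis (2 * pi * (of_int u * x)) * (\<Sum>m<nat (v - u + 1). z ^ m)"
    by (simp add: sum_distrib_left)
  finally have "?S * (1 - z) = cis (2 * pi * (of_int u * x)) * (1 - z ^ nat (v - u + 1))"
    by (simp add: one_diff_power_eq)
  then have "norm ?S * norm (1 - z) = norm (1 - z ^ nat (v - u + 1))"
    by (metis norm_mult norm_cis mult_1)
  also have "\<dots> \<le> norm (1::complex) + norm (z ^ nat (v - u + 1))" by (rule norm_triangle_ineq4)
  also have "\<dots> = 2" by (simp add: z_def norm_power)
  finally have "norm ?S * norm (1 - z) \<le> 2" .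
  moreover have "norm ?S * (2 * int_dist x) \<le> norm ?S * norm (1 - z)"
    unfolding z_def by (intro mult_left_mono int_dist_le_norm_one_minus_cis) auto
  ultimately have "norm ?S * int_dist x \<le> 1" by linarith
  moreover have "norm ?S * (1 / (2 * real M + 1)) \<le> 1" using triv by (simp add: field_simps)
  ultimately have "norm ?S * max (1 / (2 * real M + 1)) (int_dist x) \<le> 1"
    by (simp add: max_def)
  then show ?thesis
    unfolding peak_def by (subst pos_le_divide_eq) (auto simp: less_max_iff_disj)
qed

definition weyl_sum :: "nat \<Rightarrow> real \<Rightarrow> real \<Rightarrow> complex" where
  "weyl_sum M t x = (\<Sum>n\<in>{- int M..int M}. cis (2 * pi * (of_int n * x + (of_int n)\<^sup>2 * t)))"

text \<open>
  In the square of the modulus the substitution \<open>m = n + h\<close> turns the quadratic phase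
  \<open>m\<^sup>2 - n\<^sup>2\<close> into \<open>2hn + h\<^sup>2\<close>. What remains in \<open>n\<close> is a geometric sum of frequency \<open>2ht\<close>, and the
  linear phase \<open>x\<close> survives only in a unimodular factor; this is why the bound is uniform in \<open>x\<close>.
\<close>

lemma weyl_differencing:
  "(norm (weyl_sum M t x))\<^sup>2 \<le> (\<Sum>h\<in>{- (2 * int M)..2 * int M}. peak M (of_int (2 * h) * t))"
proof -
  define I where "I = {- int M..int M}"
  define H where "H = {- (2 * int M)..2 * int M}"
  define c where "c n = cis (2 * pi * (of_int n * x + (of_int n)\<^sup>2 * t))" for n :: int
  have "complex_of_real ((norm (weyl_sum M t x))\<^sup>2) = (\<Sum>n\<in>I. \<Sum>m\<in>I. c m * cnj (c n))"
  proof -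
    have W: "weyl_sum M t x = sum c I" by (simp add: weyl_sum_def I_def c_def)
    have "complex_of_real ((norm (weyl_sum M t x))\<^sup>2) = sum c I * (\<Sum>n\<in>I. cnj (c n))"
      by (simp only: complex_norm_square W cnj_sum)
    also have "\<dots> = (\<Sum>m\<in>I. \<Sum>n\<in>I. c m * cnj (c n))" by (rule sum_product)
    also have "\<dots> = (\<Sum>n\<in>I. \<Sum>m\<in>I. c m * cnj (c n))" by (rule sum.swap)
    finally show ?thesis .
  qed
  also have "\<dots> = (\<Sum>n\<in>I. \<Sum>h\<in>H. if n + h \<in> I then c (n + h) * cnj (c n) else 0)"
  proof (rule sum.cong[OF refl])
    fix n assume n: "n \<in> I"
    have "(\<Sum>m\<in>I. c m * cnj (c n)) = (\<Sum>h\<in>{h\<in>H. n + h \<in> I}. c (n + h) * cnj (c n))"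
      by (rule sum.reindex_bij_witness[of _ "\<lambda>h. n + h" "\<lambda>m. m - n"])
         (use n in \<open>auto simp: I_def H_def\<close>)
    also have "\<dots> = (\<Sum>h\<in>H. if n + h \<in> I then c (n + h) * cnj (c n) else 0)"
      by (intro sum.inter_filter) (simp add: H_def)
    finally show "(\<Sum>m\<in>I. c m * cnj (c n))
      = (\<Sum>h\<in>H. if n + h \<in> I then c (n + h) * cnj (c n) else 0)" .
  qed
  also have "\<dots> = (\<Sum>h\<in>H. \<Sum>n\<in>I. if n + h \<in> I then c (n + h) * cnj (c n) else 0)"
    by (rule sum.swap)
  finally have "(norm (weyl_sum M t x))\<^sup>2
      = norm (\<Sum>h\<in>H. \<Sum>n\<in>I. if n + h \<in> I then c (n + h) * cnj (c n) else 0)"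
    by (metis norm_of_real abs_power2)
  also have "\<dots> \<le> (\<Sum>h\<in>H. peak M (of_int (2 * h) * t))"
  proof (rule sum_norm_le)
    fix h assume "h \<in> H"
    let ?g = "cis (2 * pi * (of_int h * x + (of_int h)\<^sup>2 * t))"
    have "(\<Sum>n\<in>I. if n + h \<in> I then c (n + h) * cnj (c n) else 0)
        = (\<Sum>n\<in>{n\<in>I. n + h \<in> I}. c (n + h) * cnj (c n))"
      by (intro sum.inter_filter[symmetric]) (simp add: I_def)
    also have "{n\<in>I. n + h \<in> I} = {max (- int M) (- int M - h)..min (int M) (int M - h)}"
      by (auto simp: I_def)
    also have "(\<Sum>n\<in>\<dots>. c (n + h) * cnj (c n))
        = (\<Sum>n\<in>\<dots>. ?g * cis (2 * pi * (of_int n * (of_int (2 * h) * t))))"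
      by (intro sum.cong refl)
         (simp add: c_def cis_cnj cis_mult algebra_simps power2_eq_square)
    finally show "norm (\<Sum>n\<in>I. if n + h \<in> I then c (n + h) * cnj (c n) else 0)
        \<le> peak M (of_int (2 * h) * t)"
      by (simp only: sum_distrib_left[symmetric] norm_mult norm_cis mult_1)
         (rule norm_sum_cis_interval_le_peak; simp)
  qed
  finally show ?thesis by (simp add: H_def)
qed

text \<open>
  Admitting odd \<open>l\<close> next to the shifts \<open>l = 2h\<close> costs a constant only, and it avoids a case
  distinction on the parity of the denominator later on.
\<close>

lemma weyl_sum_square_le_sum_peaks:
  "(norm (weyl_sum M t x))\<^sup>2 \<le> (\<Sum>l\<in>{- (4 * int M)..4 * int M}. peak M (of_int l * t))"
proof -
  have "(\<Sum>h\<in>{- (2 * int M)..2 * int M}. peak M (of_int (2 * h) * t))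
      = (\<Sum>l\<in>(\<lambda>h. 2 * h) ` {- (2 * int M)..2 * int M}. peak M (of_int l * t))"
    by (subst sum.reindex) (auto simp: inj_on_def)
  also have "\<dots> \<le> (\<Sum>l\<in>{- (4 * int M)..4 * int M}. peak M (of_int l * t))"
    by (intro sum_mono2) (auto simp: peak_nonneg)
  finally show ?thesis using weyl_differencing order_trans by blast
qed

text \<open>
  Powers \<open>j powr (e - 1)\<close> with a small \<open>e > 0\<close> replace the logarithmic factors that harmonic sums
  would produce. A loss of this form is harmless, because all later exponents satisfy strict
  inequalities.
\<close>

lemma sum_powr_le:
  assumes "0 < e" "e \<le> 1"
  shows "(\<Sum>j=1..J. real j powr (e - 1)) \<le> real J powr e / e"
proof (induction J)
  case (Suc J)
  have "e * real (Suc J) powr (e - 1) \<le> real (Suc J) powr e - real J powr e"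
  proof (cases "J = 0")
    case False
    have "\<exists>z. real J < z \<and> z < real (Suc J) \<and>
        real (Suc J) powr e - real J powr e = (real (Suc J) - real J) * (e * z powr (e - 1))"
      using False by (intro MVT2) (auto intro!: derivative_eq_intros simp: field_simps)
    then obtain z where z: "real J < z" "z < real (Suc J)"
        "real (Suc J) powr e - real J powr e = e * z powr (e - 1)" by auto
    have "real (Suc J) powr (e - 1) \<le> z powr (e - 1)"
      using z(1,2) False assms by (intro powr_mono2') auto
    then show ?thesis using z(3) assms by (simp add: mult_left_mono)
  qed (use assms in auto)
  then have "real (Suc J) powr (e - 1) \<le> (real (Suc J) powr e - real J powr e) / e"
    using assms by (simp add: field_simps)
  then show ?case using Suc by (simp add: diff_divide_distrib)
qed (use assms in auto)

section \<open>Weyl sums near a rational point\<close>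

text \<open>
  Within a class of \<open>l * a\<close> modulo \<open>q\<close> the quotient \<open>l div q\<close> determines \<open>l\<close>, since \<open>a\<close> is
  invertible modulo \<open>q\<close>.
\<close>

lemma card_residue_class_le:
  fixes q a L r :: int
  assumes "0 < q" "coprime a q" "0 \<le> L"
  shows "real (card {l\<in>{-L..L}. (l * a) mod q = r}) \<le> 2 * of_int L / of_int q + 2"
proof -
  let ?A = "{l\<in>{-L..L}. (l * a) mod q = r}"
  have inj: "inj_on (\<lambda>l. l div q) ?A"
  proof (rule inj_onI)
    fix l m assume "l \<in> ?A" "m \<in> ?A" and d: "l div q = m div q"
    then have "q dvd (l - m) * a"
      by (simp add: mod_eq_dvd_iff[symmetric] left_diff_distrib)
    then have "q dvd l - m" 
      using assms(2) by (simp add: coprime_dvd_mult_left_iff coprime_commute)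
    then have "l mod q = m mod q" by (simp add: mod_eq_dvd_iff)
    then show "l = m" using d by (metis mult_div_mod_eq)
  qed
  have "card ?A = card ((\<lambda>l. l div q) ` ?A)" by (rule card_image[OF inj, symmetric])
  also have "\<dots> \<le> card {(-L) div q..L div q}"
    using assms(1) by (intro card_mono) (auto intro!: zdiv_mono1)
  finally have "int (card ?A) \<le> int (nat (L div q - (-L) div q + 1))"
    unfolding of_nat_le_iff by simp
  also have "(-L) div q \<le> L div q" using assms by (intro zdiv_mono1) auto
  then have "int (nat (L div q - (-L) div q + 1)) = L div q - (-L) div q + 1" by simp
  finally have "real (card ?A) \<le> of_int (L div q) - of_int ((-L) div q) + 1" by linarith
  moreover have "of_int (L div q) \<le> (of_int L / of_int q :: real)"
    unfolding floor_divide_of_int_eq[symmetric, where ?'a = real] by linarith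
  moreover have "of_int ((-L) div q) \<ge> (of_int (-L) / of_int q :: real) - 1"
    unfolding floor_divide_of_int_eq[symmetric, where ?'a = real] by linarith
  ultimately show ?thesis by simp
qed

lemma sum_over_residues_le:
  fixes \<phi> :: "int \<Rightarrow> real"
  assumes "0 < q" "coprime a q" "0 \<le> L" and nn: "\<And>r. r \<in> {0..<q} \<Longrightarrow> 0 \<le> \<phi> r"
  shows "(\<Sum>l\<in>{-L..L}. \<phi> ((l * a) mod q)) \<le> (2 * of_int L / of_int q + 2) * (\<Sum>r\<in>{0..<q}. \<phi> r)"
proof -
  have "(\<Sum>l\<in>{-L..L}. \<phi> ((l * a) mod q))
      = (\<Sum>r\<in>{0..<q}. \<Sum>l\<in>{l\<in>{-L..L}. (l * a) mod q = r}. \<phi> ((l * a) mod q))"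
    using assms(1) by (intro sum.group[symmetric]) auto
  also have "\<dots> = (\<Sum>r\<in>{0..<q}. real (card {l\<in>{-L..L}. (l * a) mod q = r}) * \<phi> r)"
    by (intro sum.cong refl) simp
  also have "\<dots> \<le> (\<Sum>r\<in>{0..<q}. (2 * of_int L / of_int q + 2) * \<phi> r)"
    using assms by (intro sum_mono mult_right_mono card_residue_class_le nn) auto
  finally show ?thesis by (simp add: sum_distrib_left)
qed

lemma sum_inverse_le:
  assumes "0 < e" "e \<le> 1"
  shows "(\<Sum>j=1..J. 1 / real j) \<le> real J powr e / e"
proof -
  have "(\<Sum>j=1..J. 1 / real j) = (\<Sum>j=1..J. real j powr (-1))"
    by (intro sum.cong) (auto simp: powr_minus divide_inverse)
  also have "\<dots> \<le> (\<Sum>j=1..J. real j powr (e - 1))"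
    using assms by (intro sum_mono powr_mono) auto
  also have "\<dots> \<le> real J powr e / e" by (rule sum_powr_le[OF assms])
  finally show ?thesis .
qed

lemma int_dist_fraction_ge:
  fixes r q n :: int
  assumes "0 < r" "r < q"
  shows "of_int (min r (q - r)) / of_int q \<le> int_dist (of_int n + of_int r / of_int q)"
proof -
  define k where "k = round (of_int n + of_int r / of_int q :: real) - n"
  have "int_dist (of_int n + of_int r / of_int q) = \<bar>of_int r / of_int q - of_int k\<bar>"
    by (simp add: int_dist_def k_def)
  also have "\<dots> = \<bar>of_int (r - k * q)\<bar> / of_int q"
    using assms by (simp add: field_simps abs_divide)
  also have "\<dots> \<ge> of_int (min r (q - r)) / of_int q"
  proof -
    have "min r (q - r) \<le> \<bar>r - k * q\<bar>"
    proof (cases "k \<le> 0")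
      case True
      then have "k * q \<le> 0" using assms by (simp add: mult_nonpos_nonneg)
      then show ?thesis by linarith
    next
      case False
      then have "1 * q \<le> k * q" using assms by (intro mult_right_mono) auto
      then show ?thesis by linarith
    qed
    then have "(of_int (min r (q - r)) :: real) \<le> \<bar>of_int (r - k * q)\<bar>"
      by (metis of_int_abs of_int_le_iff)
    then show ?thesis using assms by (intro divide_right_mono) auto
  qed
  finally show ?thesis .
qed

text \<open>
  A point \<open>t = a/q + b\<close> on the arc that Dirichlet's theorem with denominators up to \<open>16M\<close> provides.
  The factor 16 makes the error in \<open>l * t\<close> at most \<open>1/(4q)\<close> for every \<open>l\<close> with \<open>\<bar>l\<bar> \<le> 4M\<close>, a
  quarter of the spacing of the fractions with denominator \<open>q\<close>. The fractions \<open>l * a/q\<close> then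
  control \<open>l * t\<close> unless \<open>q\<close> divides \<open>l\<close>, and if it does, the distance of \<open>l * t\<close> to the
  nearest integer is exactly \<open>\<bar>l * b\<bar>\<close>.
\<close>

locale rational_approximation =
  fixes M :: nat and q a :: int and b :: real
  assumes M: "1 \<le> M" and q: "1 \<le> q" "q \<le> 16 * int M" and coprime: "coprime a q"
    and b: "\<bar>b\<bar> \<le> 1 / (16 * real M * of_int q)"
begin

abbreviation "t \<equiv> of_int a / of_int q + b"

lemma multiple_error_le:
  assumes "\<bar>l\<bar> \<le> 4 * int M"
  shows "\<bar>of_int l * b\<bar> \<le> 1 / (4 * of_int q)"
proof -
  have "\<bar>of_int l * b\<bar> \<le> (4 * real M) * (1 / (16 * real M * of_int q))"
    unfolding abs_mult using assms b by (intro mult_mono) auto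
  also have "\<dots> = 1 / (4 * of_int q)" using M q by (simp add: field_simps)
  finally show ?thesis .
qed

text \<open>
  For \<open>q\<close> not dividing \<open>l\<close>, the distance of \<open>l * a/q\<close> to the nearest integer is
  \<open>min r (q - r)/q\<close>, and at most a quarter of it is lost on passing to \<open>l * t\<close>. The reciprocal of
  the minimum is bounded by the sum of both reciprocals, which sums easily over \<open>r\<close>.
\<close>

lemma peak_nonmultiple:
  assumes l: "\<bar>l\<bar> \<le> 4 * int M" and r: "r = (l * a) mod q" "r \<noteq> 0"
  shows "peak M (of_int l * t) \<le> 4/3 * of_int q * (1 / of_int r + 1 / of_int (q - r))"
proof -
  define m where "m = min r (q - r)"
  have "0 \<le> r" "r < q"
    using q unfolding r(1) by simp_all
  then have rq: "0 < r" "r < q" using r(2) by linarith+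
  then have m: "m \<ge> 1" by (simp add: m_def)
  have "of_int (l * a) = (of_int ((l * a) div q * q + r) :: real)"
    unfolding r by (simp only: div_mult_mod_eq)
  then have *: "of_int l * of_int a = (of_int ((l * a) div q) * of_int q + of_int r :: real)"
    by simp
  have eq: "of_int l * t = of_int ((l * a) div q) + of_int r / of_int q + of_int l * b"
    using q * by (simp add: field_simps)
  have "of_int m / of_int q \<le> int_dist (of_int ((l * a) div q) + of_int r / of_int q)"
    unfolding m_def by (rule int_dist_fraction_ge[OF rq])
  also have "\<dots> \<le> int_dist (of_int l * t) + \<bar>of_int l * b\<bar>"
    using int_dist_triangle[of "of_int ((l * a) div q) + of_int r / of_int q" "of_int l * t"]
    by (simp add: eq)
  also have "\<bar>of_int l * b\<bar> \<le> 1 / (4 * of_int q)" by (rule multiple_error_le[OF l])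
  also have "1 / (4 * of_int q) \<le> 1/4 * (of_int m / of_int q :: real)"
    using m q by (simp add: field_simps)
  finally have ge: "3/4 * (of_int m / of_int q) \<le> int_dist (of_int l * t)" by simp
  have pos: "0 < 3/4 * (of_int m / of_int q :: real)" using m q by simp
  have "peak M (of_int l * t) \<le> 1 / int_dist (of_int l * t)"
    using ge pos by (intro peak_le_inverse) linarith
  also have "\<dots> \<le> 1 / (3/4 * (of_int m / of_int q))"
    by (rule divide_left_mono[OF ge]) (use ge pos in \<open>auto intro!: mult_pos_pos simp del: times_divide_eq_right\<close>)
  also have "\<dots> = 4/3 * of_int q * (1 / of_int m)" by simp
  also have "1 / of_int m \<le> (1 / of_int r + 1 / of_int (q - r) :: real)"
    using rq by (auto simp: m_def min_def)
  finally show ?thesis using q by (simp add: mult_left_mono)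
qed

text \<open>
  Each of the \<open>O(M/q + 1)\<close> blocks of \<open>q\<close> consecutive \<open>l\<close> runs once through the residues and
  contributes a harmonic sum \<open>q * \<Sum> 1/r\<close>. As \<open>q \<le> 16M\<close>, this gives \<open>M\<close> up to \<open>q powr e\<close>.
\<close>

lemma sum_peak_nonmultiples:
  assumes e: "0 < e" "e \<le> 1"
  shows "(\<Sum>l\<in>{l\<in>{-(4 * int M)..4 * int M}. \<not> q dvd l}. peak M (of_int l * t))
           \<le> 107 / e * real M * of_int q powr e"
proof -
  define \<phi> where "\<phi> r = (if r = 0 then 0 else
      4/3 * of_int q * (1 / of_int r + 1 / of_int (q - r)) :: real)" for r :: int
  have nn: "0 \<le> \<phi> r" if "r \<in> {0..<q}" for r using that by (auto simp: \<phi>_def)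
  have "(\<Sum>l\<in>{l\<in>{-(4 * int M)..4 * int M}. \<not> q dvd l}. peak M (of_int l * t))
      \<le> (\<Sum>l\<in>{l\<in>{-(4 * int M)..4 * int M}. \<not> q dvd l}. \<phi> ((l * a) mod q))"
  proof (intro sum_mono)
    fix l assume l: "l \<in> {l\<in>{-(4 * int M)..4 * int M}. \<not> q dvd l}"
    then have "(l * a) mod q \<noteq> 0"
      using coprime by (auto simp: mod_eq_0_iff_dvd coprime_dvd_mult_left_iff coprime_commute)
    then show "peak M (of_int l * t) \<le> \<phi> ((l * a) mod q)"
      using l peak_nonmultiple[of l "(l * a) mod q"] by (auto simp: \<phi>_def)
  qed
  also have "\<dots> \<le> (\<Sum>l\<in>{-(4 * int M)..4 * int M}. \<phi> ((l * a) mod q))"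
    using q by (intro sum_mono2) (auto intro!: nn)
  also have "\<dots> \<le> (2 * of_int (4 * int M) / of_int q + 2) * (\<Sum>r\<in>{0..<q}. \<phi> r)"
    using q coprime by (intro sum_over_residues_le nn) auto
  also have "(\<Sum>r\<in>{0..<q}. \<phi> r) \<le> 8/3 * of_int q * (of_int q powr e / e)"
  proof -
    have "(\<Sum>r\<in>{0..<q}. \<phi> r) = (\<Sum>r\<in>{1..<q}. \<phi> r)"
      by (rule sum.mono_neutral_right) (auto simp: \<phi>_def)
    also have "\<dots> = 4/3 * of_int q * ((\<Sum>r\<in>{1..<q}. 1 / of_int r) + (\<Sum>r\<in>{1..<q}. 1 / of_int (q - r)))"
      unfolding sum.distrib[symmetric] sum_distrib_left by (intro sum.cong) (auto simp: \<phi>_def)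
    also have "(\<Sum>r\<in>{1..<q}. 1 / of_int (q - r)) = (\<Sum>r\<in>{1..<q}. 1 / of_int r :: real)"
      by (rule sum.reindex_bij_witness[of _ "\<lambda>r. q - r" "\<lambda>r. q - r"]) auto
    also have "(\<Sum>r\<in>{1..<q}. 1 / of_int r :: real) = (\<Sum>j=1..nat (q - 1). 1 / real j)"
      by (rule sum.reindex_bij_witness[of _ int nat]) auto
    also have "\<dots> \<le> real (nat (q - 1)) powr e / e" by (rule sum_inverse_le[OF e])
    also have "\<dots> \<le> of_int q powr e / e"
      using q e by (intro divide_right_mono powr_mono2) auto
    finally show ?thesis using q by (simp add: mult_left_mono)
  qed
  also have "(2 * of_int (4 * int M) / of_int q + 2) * (8/3 * of_int q * (of_int q powr e / e))
      = (8 * real M + 2 * of_int q) * (8/3) * (of_int q powr e / e)"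
  proof -
    have "(2 * of_int (4 * int M) / of_int q + 2) * (8/3 * of_int q * X)
      = (8 * real M + 2 * of_int q) * (8/3) * X" for X :: real
      using q by (simp add: field_simps)
    then show ?thesis .
  qed
  also have "\<dots> \<le> (8 * real M + 2 * (16 * real M)) * (8/3) * (of_int q powr e / e)"
    using q e by (intro mult_right_mono add_left_mono) auto
  also have "\<dots> \<le> 107 / e * real M * of_int q powr e"
    using e by (simp add: field_simps mult_right_mono)
  finally show ?thesis using q by (simp add: mult_left_mono)
qed

text \<open>
  For \<open>l = q * j\<close> the reciprocal of the peak is the maximum of about \<open>1/M\<close> and \<open>q * j * \<bar>b\<bar>\<close>.
  Since \<open>q * j \<le> 4M\<close>, the former also dominates a multiple of \<open>q * j/M\<^sup>2\<close>, so the maximum is at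
  least a multiple of \<open>q * j * (1 + M\<^sup>2\<bar>b\<bar>)/M\<^sup>2\<close>. Interpolating between this and \<open>1/(3M)\<close> with weights \<open>1 - e\<close> and
  \<open>e\<close> makes the sum over \<open>j\<close> converge like a power instead of a logarithm.
\<close>

lemma peak_multiple:
  assumes j: "j \<noteq> 0" "\<bar>q * j\<bar> \<le> 4 * int M" and e: "0 < e" "e < 1"
  shows "peak M (of_int (q * j) * t)
    \<le> (3 * real M) powr e * (24 * (real M)\<^sup>2 / (of_int q * (1 + (real M)\<^sup>2 * \<bar>b\<bar>))) powr (1 - e)
        * of_int \<bar>j\<bar> powr (e - 1)"
proof -
  \<comment> \<open>\<open>w\<close> is half of \<open>q * \<bar>j\<bar>/(12M\<^sup>2)\<close> plus \<open>1/24\<close> of \<open>q * \<bar>j\<bar> * \<bar>b\<bar>\<close>; it is at most \<open>m\<close>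
    because both of these quantities are.\<close>
  define w where "w = of_int q * of_int \<bar>j\<bar> * (1 + (real M)\<^sup>2 * \<bar>b\<bar>) / (24 * (real M)\<^sup>2)"
  define m where "m = max (1 / (2 * real M + 1)) (int_dist (of_int (q * j) * t))"
  have eq: "of_int (q * j) * t = of_int (j * a) + of_int (q * j) * b"
    using q by (simp add: field_simps)
  have sm: "\<bar>of_int (q * j) * b\<bar> \<le> 1 / (4 * of_int q)" by (rule multiple_error_le[OF j(2)])
  also have "\<dots> < 1 / 2" using q by (simp add: field_simps)
  finally have "round (of_int (q * j) * t) = j * a"
    unfolding eq by (intro round_unique') simp
  then have dist: "int_dist (of_int (q * j) * t) = of_int q * of_int \<bar>j\<bar> * \<bar>b\<bar>"
  proof -
    have "int_dist (of_int (q * j) * t) = \<bar>of_int (q * j) * t - of_int (j * a)\<bar>"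
      using \<open>round (of_int (q * j) * t) = j * a\<close> by (simp only: int_dist_def)
    also have "\<dots> = \<bar>of_int (q * j) * b\<bar>" by (simp only: eq add_diff_cancel_left')
    finally show ?thesis using q by (simp add: abs_mult)
  qed
  have M1: "1 \<le> real M" using M by simp
  have "of_int q * of_int \<bar>j\<bar> \<le> (4 * real M)"
    using j(2) q by (simp add: abs_mult del: of_int_abs flip: of_int_mult)
  then have "of_int q * of_int \<bar>j\<bar> / (12 * (real M)\<^sup>2) \<le> (4 * real M) / (12 * (real M)\<^sup>2)"
    by (intro divide_right_mono) auto
  also have "\<dots> = 1 / (3 * real M)" using M1 by (simp add: field_simps power2_eq_square)
  also have "\<dots> \<le> 1 / (2 * real M + 1)" using M1 by (intro divide_left_mono) auto
  finally have 1: "of_int q * of_int \<bar>j\<bar> / (12 * (real M)\<^sup>2) \<le> m" by (simp add: m_def)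
  have "w = (of_int q * of_int \<bar>j\<bar> / (12 * (real M)\<^sup>2)) / 2
      + (of_int q * of_int \<bar>j\<bar> * \<bar>b\<bar>) / 24"
    using M1 by (simp add: w_def field_simps)
  moreover have "of_int q * of_int \<bar>j\<bar> * \<bar>b\<bar> \<le> m" 
    unfolding m_def dist by (rule max.cobounded2)
  moreover have m0: "0 < m" using M1 by (simp add: m_def less_max_iff_disj)
  moreover have "X / 2 + Y / 24 \<le> m" if "X \<le> m" "Y \<le> m" "0 < m" for X Y
    using that by linarith
  ultimately have wm: "w \<le> m" using 1 by metis
  have w0: "0 < w" using q j M1 by (auto simp: w_def intro!: divide_pos_pos mult_pos_pos add_pos_nonneg)
  have "1 / m \<le> 3 * real M"
  proof -
    have "1 / m \<le> 1 / (1 / (2 * real M + 1))"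
      unfolding m_def by (intro divide_left_mono) (auto simp: less_max_iff_disj)
    then show ?thesis using M1 by simp
  qed
  moreover have "1 / m \<le> 1 / w" using wm w0 m0 by (intro divide_left_mono) auto
  moreover have "1 / m = (1 / m) powr e * (1 / m) powr (1 - e)"
    using m0 by (simp flip: powr_add)
  ultimately have "1 / m \<le> (3 * real M) powr e * (1 / w) powr (1 - e)"
    using e m0 w0 M1 by (metis (no_types, lifting) diff_ge_0_iff_ge divide_nonneg_nonneg less_imp_le
      mult_mono powr_ge_zero powr_mono2 zero_le_one)
  also have "1 / w = 24 * (real M)\<^sup>2 / (of_int q * (1 + (real M)\<^sup>2 * \<bar>b\<bar>)) * (1 / of_int \<bar>j\<bar>)"
    by (simp add: w_def)
  also have "\<dots> powr (1 - e) = (24 * (real M)\<^sup>2 / (of_int q * (1 + (real M)\<^sup>2 * \<bar>b\<bar>))) powr (1 - e)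
      * (1 / of_int \<bar>j\<bar>) powr (1 - e)"
    using q by (intro powr_mult)
  also have "(1 / of_int \<bar>j\<bar> :: real) powr (1 - e) = of_int \<bar>j\<bar> powr (e - 1)"
    using j by (simp add: powr_divide powr_diff field_simps)
  finally show ?thesis by (simp add: peak_def m_def mult.assoc)
qed

lemma sum_peak_multiples:
  assumes e: "0 < e" "e < 1"
  shows "(\<Sum>l\<in>{l\<in>{-(4 * int M)..4 * int M}. q dvd l}. peak M (of_int l * t))
           \<le> 3 * real M + 576 / e * (real M)\<^sup>2 * (of_int q * (1 + (real M)\<^sup>2 * \<bar>b\<bar>)) powr (e - 1)"
proof -
  define J where "J = 4 * int M div q"
  define D where "D = of_int q * (1 + (real M)\<^sup>2 * \<bar>b\<bar>)"
  define K where "K = (3 * real M) powr e * (24 * (real M)\<^sup>2 / D) powr (1 - e)"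
  have M1: "1 \<le> real M" using M by simp
  have D0: "0 < D" using q by (auto simp: D_def intro!: mult_pos_pos add_pos_nonneg)
  have dom: "\<bar>q * j\<bar> \<le> 4 * int M \<longleftrightarrow> \<bar>j\<bar> \<le> J" for j
  proof -
    have "\<bar>j\<bar> \<le> J \<longleftrightarrow> (of_int \<bar>j\<bar> :: real) \<le> of_int (4 * int M) / of_int q"
      unfolding J_def floor_divide_of_int_eq[symmetric, where ?'a = real] le_floor_iff ..
    also have "\<dots> \<longleftrightarrow> (of_int (\<bar>j\<bar> * q) :: real) \<le> of_int (4 * int M)"
      using q by (simp add: pos_le_divide_eq)
    also have "\<dots> \<longleftrightarrow> \<bar>q * j\<bar> \<le> 4 * int M"
      using q unfolding of_int_le_iff by (simp add: abs_mult mult.commute)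
    finally show ?thesis by blast
  qed
  have J0: "0 \<le> J" using q by (simp add: J_def pos_imp_zdiv_nonneg_iff)
  have "(\<Sum>l\<in>{l\<in>{-(4 * int M)..4 * int M}. q dvd l}. peak M (of_int l * t))
      = (\<Sum>j\<in>{-J..J}. peak M (of_int (q * j) * t))"
  proof (rule sum.reindex_bij_witness[of _ "\<lambda>j. q * j" "\<lambda>l. l div q"])
    fix l assume l: "l \<in> {l\<in>{-(4 * int M)..4 * int M}. q dvd l}"
    then show "q * (l div q) = l" by simp
    then show "l div q \<in> {-J..J}" using l dom[of "l div q"] by auto
    show "peak M (of_int (q * (l div q)) * t) = peak M (of_int l * t)"
      using l by simp
  next
    fix j assume "j \<in> {-J..J}"
    then show "q * j \<in> {l\<in>{-(4 * int M)..4 * int M}. q dvd l}" using dom[of j] by auto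
    show "q * j div q = j" using q by simp
  qed
  also have "\<dots> = peak M (of_int (q * 0) * t) + (\<Sum>j\<in>{-J..J} - {0}. peak M (of_int (q * j) * t))"
    using J0 by (intro sum.remove) auto
  also have "\<dots> \<le> 3 * real M + (\<Sum>j\<in>{-J..J} - {0}. K * of_int \<bar>j\<bar> powr (e - 1))"
  proof (intro add_mono sum_mono)
    show "peak M (of_int (q * 0) * t) \<le> 3 * real M"
      using peak_le[of M "of_int (q * 0) * t"] M1 by linarith
    fix j assume "j \<in> {-J..J} - {0}"
    then show "peak M (of_int (q * j) * t) \<le> K * of_int \<bar>j\<bar> powr (e - 1)"
      unfolding K_def D_def using dom[of j] e by (intro peak_multiple) auto
  qed
  also have "(\<Sum>j\<in>{-J..J} - {0}. K * of_int \<bar>j\<bar> powr (e - 1))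
      = K * (\<Sum>j\<in>{1..J} \<union> {-J..-1}. of_int \<bar>j\<bar> powr (e - 1))"
    unfolding sum_distrib_left by (intro sum.cong) auto
  also have "(\<Sum>j\<in>{1..J} \<union> {-J..-1}. of_int \<bar>j\<bar> powr (e - 1))
      = (\<Sum>j\<in>{1..J}. of_int \<bar>j\<bar> powr (e - 1)) + (\<Sum>j\<in>{-J..-1}. of_int \<bar>j\<bar> powr (e - 1) :: real)"
    by (intro sum.union_disjoint) auto
  also have "(\<Sum>j\<in>{-J..-1}. of_int \<bar>j\<bar> powr (e - 1)) = (\<Sum>j\<in>{1..J}. of_int \<bar>j\<bar> powr (e - 1) :: real)"
    by (rule sum.reindex_bij_witness[of _ uminus uminus]) auto
  also have "(\<Sum>j\<in>{1..J}. of_int \<bar>j\<bar> powr (e - 1)) = (\<Sum>j=1..nat J. real j powr (e - 1))"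
    by (rule sum.reindex_bij_witness[of _ int nat]) auto
  also have "K * (\<dots> + \<dots>) \<le> K * (2 * ((4 * real M) powr e / e))"
  proof (intro mult_left_mono)
    have "(\<Sum>j=1..nat J. real j powr (e - 1)) \<le> real (nat J) powr e / e"
      using e by (intro sum_powr_le) auto
    also have "real (nat J) \<le> 4 * real M"
    proof -
      have "J \<le> 4 * int M" using dom[of J] J0 q mult_right_mono[of 1 q J] by simp
      then show ?thesis using J0 by linarith
    qed
    then have "real (nat J) powr e / e \<le> (4 * real M) powr e / e"
      using e by (intro divide_right_mono powr_mono2) auto
    finally show "(\<Sum>j=1..nat J. real j powr (e - 1)) + (\<Sum>j=1..nat J. real j powr (e - 1))
      \<le> 2 * ((4 * real M) powr e / e)" by simp
  qed (simp add: K_def)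
  also have "\<dots> = 2 / e * ((12 powr e * 24 powr (1 - e)) * ((real M) powr (2 * e) * (real M)\<^sup>2 powr (1 - e)) * D powr (e - 1))"
  proof -
    have "(3 * real M) powr e * (4 * real M) powr e = 12 powr e * real M powr (2 * e)"
    proof -
      have "(3 * real M) powr e * (4 * real M) powr e = (12 * (real M * real M)) powr e"
        by (simp add: mult_ac flip: powr_mult)
      also have "real M * real M = real M powr 2"
        using M1 by (simp add: power2_eq_square)
      also have "(12 * real M powr 2) powr e = 12 powr e * real M powr (2 * e)"
        by (simp add: powr_mult powr_powr del: powr_numeral)
      finally show ?thesis .
    qed
    moreover have "(24 * (real M)\<^sup>2 / D) powr (1 - e) = 24 powr (1 - e) * (real M)\<^sup>2 powr (1 - e) * D powr (e - 1)"
      using D0 by (simp add: powr_divide powr_mult powr_diff field_simps)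
    ultimately show ?thesis by (simp add: K_def)
  qed
  also have "(real M) powr (2 * e) * (real M)\<^sup>2 powr (1 - e) = (real M)\<^sup>2"
    using M1 by (simp add: powr_powr flip: powr_numeral powr_add)
  also have "2 / e * ((12 powr e * 24 powr (1 - e)) * (real M)\<^sup>2 * D powr (e - 1))
      \<le> 2 / e * ((12 powr 1 * 24 powr 1) * (real M)\<^sup>2 * D powr (e - 1))"
    using e by (intro mult_left_mono mult_right_mono mult_mono powr_mono) auto
  finally show ?thesis by (simp add: D_def)
qed

text \<open>
  The classical size \<open>M/\<surd>D\<close> with \<open>D = q * (1 + M\<^sup>2\<bar>b\<bar>)\<close>, up to a power \<open>D powr (e/2)\<close>. The loss is
  a power of \<open>D\<close> and not of \<open>M\<close>, and so nothing is lost on the central arcs, where \<open>D\<close> is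
  bounded. The terms of size \<open>M * q powr e\<close> are absorbed because \<open>D \<le> 17M\<close>.
\<close>

lemma weyl_sum_bound:
  assumes e: "0 < e" "e < 1"
  shows "(norm (weyl_sum M t x))\<^sup>2
    \<le> 2500 / e * (real M)\<^sup>2 * (of_int q * (1 + (real M)\<^sup>2 * \<bar>b\<bar>)) powr (e - 1)"
proof -
  define D where "D = of_int q * (1 + (real M)\<^sup>2 * \<bar>b\<bar>)"
  let ?L = "{-(4 * int M)..4 * int M}"
  have M1: "1 \<le> real M" using M by simp
  have qD: "of_int q \<le> D" using q by (simp add: D_def)
  have "of_int q * ((real M)\<^sup>2 * \<bar>b\<bar>) \<le> of_int q * ((real M)\<^sup>2 * (1 / (16 * real M * of_int q)))"
    using q b by (intro mult_left_mono) auto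
  also have "\<dots> = real M / 16" using q M1 by (simp add: field_simps power2_eq_square)
  finally have "D \<le> 17 * real M" using q M1 by (simp add: D_def distrib_left)
  have q1: "1 \<le> (of_int q :: real)" using q by simp
  have main: "real M * of_int q powr e \<le> 17 * ((real M)\<^sup>2 * D powr (e - 1))"
  proof -
    have "of_int q powr e \<le> D powr e" using q1 qD e by (intro powr_mono2) auto
    also have "\<dots> = D * D powr (e - 1)" using q1 qD by (simp add: powr_diff)
    also have "\<dots> \<le> (17 * real M) * D powr (e - 1)" using \<open>D \<le> 17 * real M\<close> by (intro mult_right_mono) auto
    finally have "real M * of_int q powr e \<le> real M * ((17 * real M) * D powr (e - 1))"
      by (intro mult_left_mono) auto
    then show ?thesis by (simp add: power2_eq_square mult_ac)
  qed
  have "real M * 1 \<le> real M * of_int q powr e"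
    using q1 e by (intro mult_left_mono ge_one_powr_ge_zero) auto
  then have main': "real M \<le> 17 * ((real M)\<^sup>2 * D powr (e - 1))" using main by simp
  have "(norm (weyl_sum M t x))\<^sup>2 \<le> (\<Sum>l\<in>?L. peak M (of_int l * t))"
    by (rule weyl_sum_square_le_sum_peaks)
  also have "\<dots> = (\<Sum>l\<in>{l\<in>?L. q dvd l}. peak M (of_int l * t)) + (\<Sum>l\<in>{l\<in>?L. \<not> q dvd l}. peak M (of_int l * t))"
  proof -
    have "finite {l\<in>?L. q dvd l}" "finite {l\<in>?L. \<not> q dvd l}"
      by (rule finite_subset[of _ ?L]; auto)+
    then show ?thesis
      by (subst sum.union_disjoint[symmetric]) (auto intro!: sum.cong simp del: atLeastAtMost_iff)
  qed
  also have "\<dots> \<le> (3 * real M + 576 / e * (real M)\<^sup>2 * D powr (e - 1)) + 107 / e * real M * of_int q powr e"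
    using sum_peak_multiples[OF e] sum_peak_nonmultiples[of e] e by (intro add_mono) (auto simp: D_def)
  also have "\<dots> \<le> 51 / e * ((real M)\<^sup>2 * D powr (e - 1)) + 576 / e * ((real M)\<^sup>2 * D powr (e - 1))
      + 1819 / e * ((real M)\<^sup>2 * D powr (e - 1))"
  proof -
    have "51 * ((real M)\<^sup>2 * D powr (e - 1)) \<le> 51 / e * ((real M)\<^sup>2 * D powr (e - 1))"
      using e by (intro mult_right_mono) (auto simp: field_simps)
    moreover have "107 / e * (real M * of_int q powr e) \<le> 107 / e * (17 * ((real M)\<^sup>2 * D powr (e - 1)))"
      using e by (intro mult_left_mono main) auto
    ultimately show ?thesis using main' unfolding mult.assoc by linarith
  qed
  also have "\<dots> = 2446 / e * ((real M)\<^sup>2 * D powr (e - 1))" by (simp add: field_simps)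
  also have "\<dots> \<le> 2500 / e * ((real M)\<^sup>2 * D powr (e - 1))"
    using e by (intro mult_right_mono divide_right_mono) auto
  finally show ?thesis by (simp add: D_def mult.assoc)
qed

end

section \<open>Moments of the maximal Weyl sum\<close>

text \<open>
  For a point of the unit interval the numerator satisfies \<open>0 \<le> a \<le> q\<close>, so that each \<open>q\<close> gives rise
  to only \<open>q + 1\<close> arcs.
\<close>

lemma dirichlet_rational_approximation:
  assumes M: "1 \<le> M" and s: "0 \<le> s" "s \<le> 1"
  obtains q a b where "rational_approximation M q a b" "0 \<le> a" "a \<le> q" "s = of_int a / of_int q + b"
proof -
  have "0 < 16 * M" using M by simp
  then obtain a q where aq: "coprime a q" "0 < q" "q \<le> int (16 * M)"
      "\<bar>of_int q * s - of_int a\<bar> < 1 / real (16 * M)"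
    by (rule Dirichlet_approx_coprime)
  have q1: "1 \<le> (of_int q :: real)" using aq(2) by simp
  have M1: "1 \<le> real M" using M by simp
  have "1 / real (16 * M) < 1" using M1 by (simp add: field_simps)
  then have lt: "\<bar>of_int q * s - of_int a\<bar> < 1" using aq(4) by linarith
  have "0 \<le> of_int q * s" "of_int q * s \<le> of_int q"
    using s q1 by (auto simp: mult_left_le)
  then have "of_int a > (-1 :: real)" "of_int a < (of_int q + 1 :: real)" using lt by linarith+
  then have "0 \<le> a" "a \<le> q" by linarith+
  moreover have "rational_approximation M q a (s - of_int a / of_int q)"
  proof
    have "s - of_int a / of_int q = (of_int q * s - of_int a) / of_int q"
      using q1 by (simp add: field_simps)
    then have "\<bar>s - of_int a / of_int q\<bar> = \<bar>of_int q * s - of_int a\<bar> / of_int q"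
      using q1 by (simp add: abs_divide)
    also have "\<dots> \<le> (1 / real (16 * M)) / of_int q"
      using aq(4) q1 by (intro divide_right_mono) auto
    finally show "\<bar>s - of_int a / of_int q\<bar> \<le> 1 / (16 * real M * of_int q)" by simp
  qed (use aq M in auto)
  ultimately show thesis by (intro that[of q a "s - of_int a / of_int q"]) auto
qed

lemma has_integral_lorentzian:
  fixes c L :: real
  assumes "0 < L"
  shows "((\<lambda>t. 1 / (1 + (L * (t - c))\<^sup>2)) has_integral
            (arctan (L * (1 - c)) / L - arctan (L * (0 - c)) / L)) {0..1}"
proof (rule fundamental_theorem_of_calculus)
  fix t :: real assume "t \<in> {0..1}"
  have "((\<lambda>t. arctan (L * (t - c)) / L) has_real_derivative 1 / (1 + (L * (t - c))\<^sup>2)) (at t within {0..1})"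
    using assms by (auto intro!: derivative_eq_intros simp: inverse_eq_divide)
  then show "((\<lambda>t. arctan (L * (t - c)) / L) has_vector_derivative 1 / (1 + (L * (t - c))\<^sup>2)) (at t within {0..1})"
    by (simp add: has_real_derivative_iff_has_vector_derivative)
qed simp

lemma integral_lorentzian_le:
  fixes c L :: real
  assumes "0 < L"
  shows "integral {0..1} (\<lambda>t. 1 / (1 + (L * (t - c))\<^sup>2)) \<le> pi / L"
proof -
  have "integral {0..1} (\<lambda>t. 1 / (1 + (L * (t - c))\<^sup>2))
      = (arctan (L * (1 - c)) - arctan (L * (0 - c))) / L"
    using has_integral_lorentzian[OF assms, of c] by (simp add: integral_unique diff_divide_distrib)
  also have "\<dots> \<le> pi / L"
    using assms arctan_bounded[of "L * (1 - c)"] arctan_bounded[of "L * (0 - c)"]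
    by (intro divide_right_mono) auto
  finally show ?thesis .
qed

text \<open>
  The arcs overlap, and each point lies on at least one of them. Summing a Lorentz profile of width
  \<open>M powr (-2)\<close> over all fractions, instead of restricting each profile to its own arc, keeps the
  majorant continuous and makes its integral explicit through the arctangent.
\<close>

definition arc_majorant :: "real \<Rightarrow> nat \<Rightarrow> real \<Rightarrow> real" where
  "arc_majorant r M t = (\<Sum>q=1..16 * M. \<Sum>a=0..q.
      real q powr (-r) * (1 / (1 + ((real M)\<^sup>2 * (t - real a / real q))\<^sup>2)))"

lemma continuous_arc_majorant: "continuous_on S (arc_majorant r M)"
  unfolding arc_majorant_def
  by (intro continuous_intros) (simp add: add_nonneg_eq_0_iff)

text \<open>
  Each of the \<open>q + 1\<close> profiles for the denominator \<open>q\<close> has mass at most \<open>\<pi>/M\<^sup>2\<close>, which leaves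
  the series of \<open>q powr (1 - r)\<close>. Its convergence is the reason for \<open>r > 2\<close>.
\<close>

lemma integral_arc_majorant:
  assumes r: "2 < r"
  shows "\<exists>C>0. \<forall>M\<ge>1. integral {0..1} (arc_majorant r M) \<le> C / (real M)\<^sup>2"
proof (intro exI conjI allI impI)
  let ?Z = "\<Sum>q. real q powr (1 - r)"
  have sm: "summable (\<lambda>q. real q powr (1 - r))" using r by (simp add: summable_real_powr_iff)
  then show "0 < 2 * pi * (?Z + 1)"
    by (intro mult_pos_pos add_nonneg_pos suminf_nonneg) auto
  fix M :: nat assume "1 \<le> M"
  then have M2: "0 < (real M)\<^sup>2" by simp
  let ?l = "\<lambda>q a t. 1 / (1 + ((real M)\<^sup>2 * (t - real a / real q))\<^sup>2)"
  have int: "?l q a integrable_on {0..1}" for q a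
    using has_integral_lorentzian[OF M2, of "real a / real q"] by blast
  have "integral {0..1} (arc_majorant r M)
      = (\<Sum>q=1..16 * M. \<Sum>a=0..q. real q powr (-r) * integral {0..1} (?l q a))"
    unfolding arc_majorant_def
    by (subst integral_sum, simp, intro integrable_sum integrable_on_mult_right int, simp)
       (intro sum.cong refl, subst integral_sum, simp, intro integrable_on_mult_right int,
        simp only: integral_mult_right)
  also have "\<dots> \<le> (\<Sum>q=1..16 * M. \<Sum>a=0..q. real q powr (-r) * (pi / (real M)\<^sup>2))"
    by (intro sum_mono mult_left_mono integral_lorentzian_le M2) auto
  also have "\<dots> = pi / (real M)\<^sup>2 * (\<Sum>q=1..16 * M. (real q + 1) * real q powr (-r))"
    by (simp add: sum_distrib_left mult_ac add_ac)
  also have "\<dots> \<le> pi / (real M)\<^sup>2 * (\<Sum>q=1..16 * M. 2 * real q powr (1 - r))"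
  proof (intro mult_left_mono sum_mono)
    fix q assume "q \<in> {1..16 * M}"
    then have "(real q + 1) * real q powr (-r) \<le> (2 * real q) * real q powr (-r)"
      by (intro mult_right_mono) auto
    also have "\<dots> = 2 * real q powr (1 - r)"
      using \<open>q \<in> {1..16 * M}\<close> by (simp add: powr_diff powr_minus divide_inverse)
    finally show "(real q + 1) * real q powr (-r) \<le> 2 * real q powr (1 - r)" .
  qed auto
  also have "\<dots> = 2 * pi / (real M)\<^sup>2 * (\<Sum>q=1..16 * M. real q powr (1 - r))"
    by (simp add: sum_distrib_left[symmetric])
  also have "\<dots> \<le> 2 * pi / (real M)\<^sup>2 * (?Z + 1)"
  proof (intro mult_left_mono)
    have "(\<Sum>q=1..16 * M. real q powr (1 - r)) \<le> ?Z" by (intro sum_le_suminf sm) auto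
    then show "(\<Sum>q=1..16 * M. real q powr (1 - r)) \<le> ?Z + 1" by simp
  qed simp
  finally show "integral {0..1} (arc_majorant r M) \<le> 2 * pi * (?Z + 1) / (real M)\<^sup>2" by simp
qed

text \<open>
  The pointwise bound raised to the power \<open>s\<close> decays like \<open>D powr (-r)\<close> with \<open>r = (1 - e) * s/2\<close>, and
  \<open>e\<close> can be taken so small that \<open>r > 2\<close> because \<open>s > 4\<close>.
\<close>

lemma weyl_sum_powr_le_arc_majorant:
  assumes s: "4 < s"
  shows "\<exists>r>2. \<exists>C>0. \<forall>M\<ge>1. \<forall>t\<in>{0..1}. \<forall>x.
           norm (weyl_sum M t x) powr s \<le> C * real M powr s * arc_majorant r M t"
proof -
  define e where "e = (1 - 4 / s) / 2"
  have e: "0 < e" "e < 1" using s by (auto simp: e_def field_simps)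
  define r where "r = (1 - e) * (s / 2)"
  have r: "2 < r" using s by (simp add: r_def e_def field_simps)
  define C where "C = (2500 / e) powr (s / 2)"
  have "norm (weyl_sum M u x) powr s \<le> C * real M powr s * arc_majorant r M u"
    if M: "1 \<le> M" and u: "u \<in> {0..1}" for M u x
  proof -
    from u have u': "0 \<le> u" "u \<le> 1" by auto
    obtain q a b where ra: "rational_approximation M q a b" and a: "0 \<le> a" "a \<le> q"
      and ueq: "u = of_int a / of_int q + b"
      by (rule dirichlet_rational_approximation[OF M u'])
    interpret rational_approximation M q a b by (rule ra)
    define B where "B = (real M)\<^sup>2 * \<bar>b\<bar>"
    define D where "D = of_int q * (1 + B)"
    have B0: "0 \<le> B" by (simp add: B_def)
    have q1: "1 \<le> (of_int q :: real)" using q by simp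
    have D0: "0 < D" using q1 B0 by (simp add: D_def)
    have "(norm (weyl_sum M u x))\<^sup>2 \<le> 2500 / e * (real M)\<^sup>2 * D powr (e - 1)"
      unfolding ueq D_def B_def by (rule weyl_sum_bound[OF e])
    then have "((norm (weyl_sum M u x))\<^sup>2) powr (s / 2)
        \<le> (2500 / e * (real M)\<^sup>2 * D powr (e - 1)) powr (s / 2)"
      using s by (intro powr_mono2) auto
    also have "\<dots> = C * ((real M)\<^sup>2) powr (s / 2) * D powr (-r)"
    proof -
      have "(e - 1) * (s / 2) = -r" by (simp add: r_def field_simps)
      then show ?thesis by (simp only: C_def powr_mult powr_powr)
    qed
    also have "((real M)\<^sup>2) powr (s / 2) = real M powr s"
      using M by (simp add: powr_powr flip: powr_numeral)
    also have "((norm (weyl_sum M u x))\<^sup>2) powr (s / 2) = norm (weyl_sum M u x) powr s"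
      by (cases "weyl_sum M u x = 0") (simp_all add: powr_powr flip: powr_numeral)
    finally have 1: "norm (weyl_sum M u x) powr s \<le> C * real M powr s * D powr (-r)" .
    have "D powr (-r) = of_int q powr (-r) * (1 + B) powr (-r)"
      by (simp add: D_def powr_mult)
    also have "(1 + B) powr (-r) \<le> (1 + B) powr (-2)"
      using B0 r by (intro powr_mono) auto
    also have "\<dots> = 1 / (1 + B)\<^sup>2" using B0 by (simp add: powr_minus divide_inverse)
    also have "\<dots> \<le> 1 / (1 + B\<^sup>2)"
      using B0 by (intro divide_left_mono) (auto simp: power2_eq_square algebra_simps add_pos_nonneg)
    also have "B\<^sup>2 = ((real M)\<^sup>2 * (u - real (nat a) / real (nat q)))\<^sup>2"
      using a q by (simp add: B_def ueq power_mult_distrib)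
    also have "(of_int q :: real) = real (nat q)" using q by simp
    finally have "D powr (-r) \<le> real (nat q) powr (-r) *
        (1 / (1 + ((real M)\<^sup>2 * (u - real (nat a) / real (nat q)))\<^sup>2))"
      by (simp add: mult_left_mono)
    also have "\<dots> \<le> (\<Sum>a=0..nat q. real (nat q) powr (-r) *
        (1 / (1 + ((real M)\<^sup>2 * (u - real a / real (nat q)))\<^sup>2)))"
      using a by (intro member_le_sum[where f = "\<lambda>a. real (nat q) powr (-r) *
        (1 / (1 + ((real M)\<^sup>2 * (u - real a / real (nat q)))\<^sup>2))"]) auto
    also have "\<dots> \<le> arc_majorant r M u"
      unfolding arc_majorant_def
      using q by (intro member_le_sum[where f = "\<lambda>q. \<Sum>a=0..q. real q powr (-r) *
        (1 / (1 + ((real M)\<^sup>2 * (u - real a / real q))\<^sup>2))"]) (auto intro!: sum_nonneg)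
    finally have "C * real M powr s * D powr (-r) \<le> C * real M powr s * arc_majorant r M u"
      by (intro mult_left_mono) (auto simp: C_def)
    with 1 show ?thesis by simp
  qed
  moreover have "0 < C" using e by (simp add: C_def)
  ultimately show ?thesis using r by blast
qed

text \<open>
  The supremum over the linear phase costs nothing in the \<open>s\<close>-th moment for \<open>s > 4\<close>: the size
  \<open>M powr (s - 2)\<close> is that of the contribution of \<open>\<bar>t\<bar> \<le> 1/M\<^sup>2\<close> alone. Passing to a continuous
  majorant \<open>G\<close> avoids integrating a supremum.
\<close>

lemma weyl_sum_maximal_moment:
  assumes "4 < s"
  shows "\<exists>C>0. \<forall>M\<ge>1. \<exists>G. continuous_on {0..1} G \<and>
           integral {0..1} G \<le> C * real M powr (s - 2) \<and>
           (\<forall>t\<in>{0..1}. \<forall>x. norm (weyl_sum M t x) powr s \<le> G t)"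
proof -
  obtain r C1 where r: "2 < r" and C1: "0 < C1" and
    bound: "\<And>M t x. 1 \<le> M \<Longrightarrow> t \<in> {0..1} \<Longrightarrow>
      norm (weyl_sum M t x) powr s \<le> C1 * real M powr s * arc_majorant r M t"
    using weyl_sum_powr_le_arc_majorant[OF assms] by blast
  obtain C2 where C2: "0 < C2" "\<And>M. 1 \<le> M \<Longrightarrow> integral {0..1} (arc_majorant r M) \<le> C2 / (real M)\<^sup>2"
    using integral_arc_majorant[OF r] by blast
  show ?thesis
  proof (intro exI[of _ "C1 * C2"] conjI allI impI)
    fix M :: nat assume M: "1 \<le> M"
    let ?G = "\<lambda>t. C1 * real M powr s * arc_majorant r M t"
    have "integral {0..1} ?G = C1 * real M powr s * integral {0..1} (arc_majorant r M)"
      by (rule integral_mult_right)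
    also have "\<dots> \<le> C1 * real M powr s * (C2 / (real M)\<^sup>2)"
      using C1 C2(2)[OF M] by (intro mult_left_mono) auto
    also have "\<dots> = C1 * C2 * real M powr (s - 2)"
      using M by (simp add: powr_diff)
    finally show "\<exists>G. continuous_on {0..1} G \<and>
           integral {0..1} G \<le> C1 * C2 * real M powr (s - 2) \<and>
           (\<forall>t\<in>{0..1}. \<forall>x. norm (weyl_sum M t x) powr s \<le> G t)"
      using bound[OF M] by (intro exI[of _ ?G]) (auto intro!: continuous_intros continuous_arc_majorant)
  qed (use C1 C2 in auto)
qed

section \<open>Characters of the torus\<close>

lemma has_integral_cis:
  "((\<lambda>t. cis (2 * pi * (of_int n * t))) has_integral (if n = 0 then 1 else 0)) {0..1}"
proof (cases "n = 0")
  case True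
  then show ?thesis using has_integral_const_real[of "1::complex" 0 1] by simp
next
  case False
  define c where "c = \<i> * of_real (2 * pi * of_int n)"
  have c: "c \<noteq> 0" using False by (simp add: c_def)
  have cis_eq: "cis (2 * pi * (of_int n * t)) = exp (c * of_real t)" for t
    by (simp add: c_def cis_conv_exp mult_ac)
  have "((\<lambda>t. exp (c * of_real t)) has_integral (exp (c * of_real 1) / c - exp (c * of_real 0) / c)) {0..1}"
  proof (rule fundamental_theorem_of_calculus)
    fix t :: real
    have "((\<lambda>z. exp (c * z) / c) has_field_derivative exp (c * of_real t)) (at (of_real t))"
      using c by (auto intro!: derivative_eq_intros)
    then have "((\<lambda>t. exp (c * of_real t) / c) has_vector_derivative exp (c * of_real t)) (at t)"
      by (rule has_vector_derivative_real_field)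
    then show "((\<lambda>t. exp (c * of_real t) / c) has_vector_derivative exp (c * of_real t)) (at t within {0..1})"
      by (rule has_vector_derivative_at_within)
  qed simp
  moreover have "exp (c * of_real 1) = 1"
    unfolding cis_eq[symmetric] by (simp add: cis_multiple_2pi)
  ultimately show ?thesis using False by (simp add: cis_eq)
qed

definition torus :: "(real ^ 'd) measure" where
  "torus = restrict_space lborel (cbox 0 1)"

definition character :: "real ^ 'd \<Rightarrow> real ^ 'd \<Rightarrow> complex" where
  "character k x = cis (2 * pi * (k \<bullet> x))"

lemma space_torus [simp]: "space torus = cbox 0 1"
  by (simp add: torus_def space_restrict_space)

lemma finite_measure_torus: "finite_measure (torus :: (real ^ 'd) measure)"
  by (rule finite_measureI) (simp add: torus_def emeasure_restrict_space space_restrict_space emeasure_lborel_cbox_eq)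

lemma LINT_cube_eq_torus:
  fixes f :: "real ^ 'd \<Rightarrow> 'b::{banach, second_countable_topology}"
  shows "(LINT x:cbox 0 1|lborel. f x) = integral\<^sup>L torus f"
  unfolding torus_def set_lebesgue_integral_def by (rule integral_restrict_space[symmetric]) auto

lemma borel_measurable_torus [measurable (raw)]:
  "f \<in> borel_measurable borel \<Longrightarrow> f \<in> borel_measurable torus"
  unfolding torus_def by (rule measurable_restrict_space1) simp

lemma character_measurable [measurable]: "character k \<in> borel_measurable borel"
  unfolding character_def cis_conv_exp by (intro borel_measurable_continuous_onI continuous_intros)

lemma cnj_measurable [measurable (raw)]:
  "f \<in> borel_measurable M \<Longrightarrow> (\<lambda>x. cnj (f x)) \<in> borel_measurable M"
  by (rule borel_measurable_continuous_on[where f = cnj]) (intro continuous_intros)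

lemma norm_character [simp]: "norm (character k x) = 1"
  by (simp add: character_def)

lemma character_mult: "character k x * character l x = character (k + l) x"
  by (simp add: character_def cis_mult inner_add_left distrib_left)

lemma cnj_character: "cnj (character k x) = character (- k) x"
  by (simp add: character_def cis_cnj)

lemma integrable_torus_bounded:
  fixes f :: "real ^ 'd \<Rightarrow> 'b::{banach, second_countable_topology}"
  assumes "f \<in> borel_measurable torus" "\<And>x. norm (f x) \<le> B"
  shows "integrable torus f"
  using assms by (intro finite_measure.integrable_const_bound[OF finite_measure_torus]) auto

text \<open>
  The integral over the cube factorises into one-dimensional integrals over \<open>[0,1]\<close>, one for each
  coordinate.
\<close>

lemma integral_character:
  fixes k :: "real ^ 'd"
  assumes "\<And>i. k $ i \<in> \<int>"
  shows "integral\<^sup>L torus (character k) = (if k = 0 then 1 else 0)"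
proof -
  define g where "g b y = indicator {0..1} y *\<^sub>R cis (2 * pi * ((k \<bullet> b) * y))" for b :: "real ^ 'd" and y :: real
  have int_one: "integrable lborel (g b)" "integral\<^sup>L lborel (g b) = (if k \<bullet> b = 0 then 1 else 0)"
    if bB: "b \<in> Basis" for b
  proof -
    obtain i where "b = axis i 1" using bB by (auto simp: Basis_vec_def)
    then have "k \<bullet> b \<in> \<int>" using assms by (simp add: inner_axis)
    then obtain n where n: "k \<bullet> b = of_int n" by (elim Ints_cases)
    have "continuous_on {0..1} (\<lambda>y. cis (2 * pi * ((k \<bullet> b) * y)))"
      unfolding cis_conv_exp by (intro continuous_intros)
    then have si: "set_integrable lborel {0..1} (\<lambda>y. cis (2 * pi * ((k \<bullet> b) * y)))"
      by (rule borel_integrable_atLeastAtMost')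
    then show "integrable lborel (g b)" by (simp add: set_integrable_def g_def[abs_def])
    have "integral\<^sup>L lborel (g b) = integral {0..1} (\<lambda>y. cis (2 * pi * ((k \<bullet> b) * y)))"
      using set_borel_integral_eq_integral(2)[OF si] by (simp add: set_lebesgue_integral_def g_def[abs_def])
    then show "integral\<^sup>L lborel (g b) = (if k \<bullet> b = 0 then 1 else 0)"
      using has_integral_cis[of n] by (simp add: n integral_unique)
  qed
  have gm [measurable]: "g b \<in> borel_measurable borel" for b
  proof -
    have [measurable]: "(\<lambda>y. cis (2 * pi * ((k \<bullet> b) * y))) \<in> borel_measurable borel"
      unfolding cis_conv_exp by (intro borel_measurable_continuous_onI continuous_intros)
    show ?thesis unfolding g_def by measurable
  qed
  interpret product_sigma_finite "\<lambda>_. lborel :: real measure" ..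
  have inner_Basis_one: "(1 :: real ^ 'd) \<bullet> b = 1" if "b \<in> Basis" for b
    using that by (auto simp: Basis_vec_def inner_axis)
  have eq: "indicator (cbox 0 1) x *\<^sub>R character k x = (\<Prod>b\<in>Basis. g b (x \<bullet> b))" for x
  proof (cases "x \<in> cbox 0 1")
    case True
    then have "\<forall>b\<in>Basis. x \<bullet> b \<in> {0..1}"
      by (auto simp: mem_box inner_Basis_one)
    then have "(\<Prod>b\<in>Basis. g b (x \<bullet> b)) = (\<Prod>b\<in>Basis. exp (\<i> * of_real (2 * pi * ((k \<bullet> b) * (x \<bullet> b)))))"
      by (intro prod.cong) (auto simp: g_def cis_conv_exp)
    also have "\<dots> = exp (\<i> * of_real (2 * pi * (k \<bullet> x)))"
      by (subst euclidean_inner[of k x]) (simp add: exp_sum sum_distrib_left)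
    finally show ?thesis using True by (simp add: character_def cis_conv_exp)
  next
    case False
    then obtain b where "b \<in> Basis" "x \<bullet> b \<notin> {0..1}"
      by (auto simp: mem_box inner_Basis_one)
    then have "(\<Prod>b\<in>Basis. g b (x \<bullet> b)) = 0"
      by (intro prod_zero) (auto simp: g_def intro!: bexI[of _ b])
    then show ?thesis using False by simp
  qed
  have "integral\<^sup>L torus (character k) = (\<integral>x. indicator (cbox 0 1) x *\<^sub>R character k x \<partial>lborel)"
    by (simp add: LINT_cube_eq_torus[symmetric] set_lebesgue_integral_def)
  also have "\<dots> = (\<integral>x. (\<Prod>b\<in>Basis. g b (x \<bullet> b)) \<partial>(distr (\<Pi>\<^sub>M b\<in>Basis. lborel) borel (\<lambda>f. \<Sum>b\<in>Basis. f b *\<^sub>R b)))"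
    by (simp only: eq lborel_eq[symmetric])
  also have "\<dots> = (\<integral>f. (\<Prod>b\<in>Basis. g b ((\<Sum>b\<in>Basis. f b *\<^sub>R b) \<bullet> b)) \<partial>(\<Pi>\<^sub>M b\<in>(Basis::(real^'d) set). lborel))"
    by (rule integral_distr) auto
  also have "\<dots> = (\<integral>f. (\<Prod>b\<in>Basis. g b (f b)) \<partial>(\<Pi>\<^sub>M b\<in>(Basis::(real^'d) set). lborel))"
    by simp
  also have "\<dots> = (\<Prod>b\<in>(Basis::(real^'d) set). integral\<^sup>L lborel (g b))"
    by (rule product_integral_prod) (auto intro: int_one)
  also have "\<dots> = (\<Prod>b\<in>(Basis::(real^'d) set). if k \<bullet> b = 0 then 1 else 0)"
    by (intro prod.cong refl int_one)
  also have "\<dots> = (if k = 0 then 1 else 0)"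
    by (auto simp: euclidean_eq_iff[of k])
  finally show ?thesis .
qed

lemma integral_character_mult_cnj:
  fixes k l :: "real ^ 'd"
  assumes "\<And>i. k $ i \<in> \<int>" "\<And>i. l $ i \<in> \<int>"
  shows "(\<integral>x. character k x * cnj (character l x) \<partial>torus) = (if k = l then 1 else 0)"
proof -
  have "(\<integral>x. character k x * cnj (character l x) \<partial>torus) = integral\<^sup>L torus (character (k - l))"
    by (simp add: cnj_character character_mult)
  also have "\<dots> = (if k - l = 0 then 1 else 0)"
    using assms by (intro integral_character) (simp add: Ints_diff)
  finally show ?thesis by simp
qed

definition fourier_coeff :: "(real ^ 'd \<Rightarrow> complex) \<Rightarrow> real ^ 'd \<Rightarrow> complex" where
  "fourier_coeff g k = (\<integral>x. g x * cnj (character k x) \<partial>torus)"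

lemma parseval_trig_polynomial:
  fixes a :: "real ^ 'd \<Rightarrow> complex"
  assumes S: "finite S" "\<And>k i. k \<in> S \<Longrightarrow> k $ i \<in> \<int>"
  shows "(\<integral>x. (norm (\<Sum>k\<in>S. a k * character k x))\<^sup>2 \<partial>torus) = (\<Sum>k\<in>S. (norm (a k))\<^sup>2)"
proof -
  have "complex_of_real (\<integral>x. (norm (\<Sum>k\<in>S. a k * character k x))\<^sup>2 \<partial>torus)
      = (\<integral>x. complex_of_real ((norm (\<Sum>k\<in>S. a k * character k x))\<^sup>2) \<partial>torus)"
    by (rule integral_complex_of_real[symmetric])
  also have "\<dots> = (\<integral>x. (\<Sum>k\<in>S. \<Sum>l\<in>S. a k * cnj (a l) * (character k x * cnj (character l x))) \<partial>torus)"
    unfolding complex_norm_square cnj_sum sum_product complex_cnj_mult by (simp add: mult_ac)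
  also have "\<dots> = (\<Sum>k\<in>S. \<Sum>l\<in>S. \<integral>x. a k * cnj (a l) * (character k x * cnj (character l x)) \<partial>torus)"
  proof -
    have int: "integrable torus (\<lambda>x. a k * cnj (a l) * (character k x * cnj (character l x)))" for k l
      by (intro integrable_torus_bounded[where B = "norm (a k * cnj (a l))"]) (simp_all add: norm_mult)
    show ?thesis using int by (simp add: Bochner_Integration.integral_sum)
  qed
  also have "\<dots> = (\<Sum>k\<in>S. \<Sum>l\<in>S. a k * cnj (a l) * (if k = l then 1 else 0))"
    using S(2) by (intro sum.cong refl) (simp add: integral_character_mult_cnj)
  also have "\<dots> = (\<Sum>k\<in>S. a k * cnj (a k))"
    using S(1) by (intro sum.cong refl) (simp add: sum.delta' if_distrib cong: if_cong)
  also have "\<dots> = complex_of_real (\<Sum>k\<in>S. (norm (a k))\<^sup>2)"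
    unfolding of_real_sum complex_norm_square ..
  finally show ?thesis by (simp only: of_real_eq_iff)
qed

lemma bessel_inequality:
  fixes g :: "real ^ 'd \<Rightarrow> complex"
  assumes S: "finite S" "\<And>k i. k \<in> S \<Longrightarrow> k $ i \<in> \<int>"
    and g [measurable]: "g \<in> borel_measurable torus" and bd: "\<And>x. norm (g x) \<le> B"
  shows "(\<Sum>k\<in>S. (norm (fourier_coeff g k))\<^sup>2) \<le> (\<integral>x. (norm (g x))\<^sup>2 \<partial>torus)"
proof -
  define P where "P x = (\<Sum>k\<in>S. fourier_coeff g k * character k x)" for x
  have Pm [measurable]: "P \<in> borel_measurable torus" unfolding P_def by measurable
  have Pb: "norm (P x) \<le> (\<Sum>k\<in>S. norm (fourier_coeff g k))" for x
    unfolding P_def by (rule sum_norm_le) (simp add: norm_mult)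
  let ?A = "\<Sum>k\<in>S. (norm (fourier_coeff g k))\<^sup>2"
  have i1: "integrable torus (\<lambda>x. (norm (g x))\<^sup>2)"
    using bd by (intro integrable_torus_bounded[where B = "B\<^sup>2"]) (auto intro!: power_mono)
  have i2: "integrable torus (\<lambda>x. (norm (P x))\<^sup>2)"
    using Pb by (intro integrable_torus_bounded[where B = "(\<Sum>k\<in>S. norm (fourier_coeff g k))\<^sup>2"])
      (auto intro!: power_mono)
  have B0: "0 \<le> B" using bd norm_ge_zero order_trans by blast
  have i3: "integrable torus (\<lambda>x. g x * cnj (P x))"
    using Pb bd B0 by (intro integrable_torus_bounded[where B = "B * (\<Sum>k\<in>S. norm (fourier_coeff g k))"])
      (auto intro!: mult_mono simp: norm_mult)
  have "(\<integral>x. g x * cnj (P x) \<partial>torus) = (\<integral>x. (\<Sum>k\<in>S. cnj (fourier_coeff g k) * (g x * cnj (character k x))) \<partial>torus)"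
    by (simp add: P_def sum_distrib_left mult_ac)
  also have "\<dots> = (\<Sum>k\<in>S. \<integral>x. cnj (fourier_coeff g k) * (g x * cnj (character k x)) \<partial>torus)"
    using bd by (intro Bochner_Integration.integral_sum integrable_mult_right integrable_torus_bounded[where B = B])
      (auto simp: norm_mult)
  also have "\<dots> = (\<Sum>k\<in>S. cnj (fourier_coeff g k) * fourier_coeff g k)"
    by (simp add: fourier_coeff_def)
  also have "\<dots> = complex_of_real ?A"
    unfolding of_real_sum complex_norm_square by (simp add: mult.commute)
  finally have gP: "(\<integral>x. g x * cnj (P x) \<partial>torus) = complex_of_real ?A" .
  have "0 \<le> (\<integral>x. (norm (g x - P x))\<^sup>2 \<partial>torus)" by (intro integral_nonneg_AE) auto
  also have "\<dots> = (\<integral>x. (norm (g x))\<^sup>2 + (norm (P x))\<^sup>2 - 2 * Re (g x * cnj (P x)) \<partial>torus)"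
    by (intro Bochner_Integration.integral_cong refl)
       (simp only: cmod_power2, simp add: power2_eq_square algebra_simps)
  also have "\<dots> = (\<integral>x. (norm (g x))\<^sup>2 \<partial>torus) + (\<integral>x. (norm (P x))\<^sup>2 \<partial>torus)
      - 2 * Re (\<integral>x. g x * cnj (P x) \<partial>torus)"
  proof -
    have i4: "integrable torus (\<lambda>x. 2 * Re (g x * cnj (P x)))"
      by (intro integrable_mult_right integrable_Re i3)
    have "(\<integral>x. 2 * Re (g x * cnj (P x)) \<partial>torus) = 2 * Re (\<integral>x. g x * cnj (P x) \<partial>torus)"
      by (simp only: integral_mult_right_zero integral_Re[OF i3])
    then show ?thesis
      by (simp only: Bochner_Integration.integral_diff[OF Bochner_Integration.integrable_add[OF i1 i2] i4]
          Bochner_Integration.integral_add[OF i1 i2])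
  qed
  also have "\<dots> = (\<integral>x. (norm (g x))\<^sup>2 \<partial>torus) - ?A"
  proof -
    have PP: "(\<integral>x. (norm (P x))\<^sup>2 \<partial>torus) = ?A"
      unfolding P_def by (rule parseval_trig_polynomial[OF S])
    show ?thesis unfolding gP PP Re_complex_of_real by simp
  qed
  finally show ?thesis by simp
qed

section \<open>Extracting a sphere from a box of frequencies\<close>

definition lattice_box :: "nat \<Rightarrow> (real ^ 'd) set" where
  "lattice_box M = {k. \<forall>i. k $ i \<in> \<int> \<and> \<bar>k $ i\<bar> \<le> real M}"

lemma lattice_box_eq_image:
  "lattice_box M = (\<lambda>f. \<chi> i. of_int (f i)) ` (UNIV \<rightarrow>\<^sub>E {- int M..int M})"
proof (intro subset_antisym subsetI)
  fix k :: "real ^ 'd" assume k: "k \<in> lattice_box M"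
  have "k = (\<chi> i. of_int \<lfloor>k $ i\<rfloor>)"
    using k by (auto simp: lattice_box_def vec_eq_iff)
  moreover have "(\<lambda>i. \<lfloor>k $ i\<rfloor>) \<in> UNIV \<rightarrow>\<^sub>E {- int M..int M}"
  proof (rule PiE_I)
    fix i
    obtain n where n: "k $ i = of_int n" using k by (auto simp: lattice_box_def elim: Ints_cases)
    have "\<bar>k $ i\<bar> \<le> real M" using k by (simp add: lattice_box_def)
    then have "\<bar>n\<bar> \<le> int M" unfolding n by linarith
    then show "\<lfloor>k $ i\<rfloor> \<in> {- int M..int M}" by (auto simp: n)
  qed simp
  ultimately show "k \<in> (\<lambda>f. \<chi> i. of_int (f i)) ` (UNIV \<rightarrow>\<^sub>E {- int M..int M})"
    by (rule image_eqI)
next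
  fix k :: "real ^ 'd" assume "k \<in> (\<lambda>f. \<chi> i. of_int (f i)) ` (UNIV \<rightarrow>\<^sub>E {- int M..int M})"
  then obtain f where f: "f \<in> UNIV \<rightarrow>\<^sub>E {- int M..int M}" and k: "k = (\<chi> i. of_int (f i))" by blast
  have "\<bar>of_int (f i)\<bar> \<le> real M" for i
  proof -
    have "\<bar>f i\<bar> \<le> int M" using PiE_mem[OF f, of i] by auto
    then show ?thesis by linarith
  qed
  then show "k \<in> lattice_box M" by (auto simp: lattice_box_def k)
qed

lemma finite_lattice_box: "finite (lattice_box M)"
  unfolding lattice_box_eq_image by (intro finite_imageI finite_PiE) auto

definition box_kernel :: "nat \<Rightarrow> real \<Rightarrow> real ^ 'd \<Rightarrow> complex" where
  "box_kernel M t z = (\<Sum>k\<in>lattice_box M. cis (2 * pi * ((norm k)\<^sup>2 * t)) * character k z)"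

text \<open>
  The box is a product and \<open>\<bar>k\<bar>\<^sup>2\<close> is a sum over the coordinates, so the exponential sum factorises.
  This is why frequencies are first relaxed from the sphere to a box.
\<close>

lemma box_kernel_eq_prod: "box_kernel M t z = (\<Prod>i\<in>UNIV. weyl_sum M t (z $ i))"
proof -
  let ?v = "\<lambda>f :: 'd \<Rightarrow> int. (\<chi> i. of_int (f i)) :: real ^ 'd"
  have inj: "inj_on ?v (UNIV \<rightarrow>\<^sub>E {- int M..int M})"
    by (auto simp: inj_on_def vec_eq_iff)
  have phase_eq: "cis (2 * pi * ((norm (?v f))\<^sup>2 * t)) * character (?v f) z
      = (\<Prod>i\<in>UNIV. cis (2 * pi * (of_int (f i) * z $ i + (of_int (f i))\<^sup>2 * t)))" for f
  proof -
    have "(norm (?v f))\<^sup>2 = (\<Sum>i\<in>UNIV. (of_int (f i))\<^sup>2)"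
      unfolding power2_norm_eq_inner by (simp add: inner_vec_def power2_eq_square)
    moreover have "?v f \<bullet> z = (\<Sum>i\<in>UNIV. of_int (f i) * z $ i)"
      by (simp add: inner_vec_def)
    ultimately have "cis (2 * pi * ((norm (?v f))\<^sup>2 * t)) * character (?v f) z
        = exp (\<i> * of_real (\<Sum>i\<in>UNIV. 2 * pi * (of_int (f i) * z $ i + (of_int (f i))\<^sup>2 * t)))"
      unfolding character_def cis_mult unfolding cis_conv_exp
      by (intro arg_cong[where f = exp] arg_cong[where f = "\<lambda>x. \<i> * of_real x"])
         (simp add: sum_distrib_left sum_distrib_right sum.distrib distrib_left algebra_simps)
    also have "\<dots> = (\<Prod>i\<in>UNIV. cis (2 * pi * (of_int (f i) * z $ i + (of_int (f i))\<^sup>2 * t)))"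
      unfolding cis_conv_exp of_real_sum sum_distrib_left by (rule exp_sum) simp
    finally show ?thesis .
  qed
  have "box_kernel M t z = (\<Sum>f\<in>UNIV \<rightarrow>\<^sub>E {- int M..int M}.
      cis (2 * pi * ((norm (?v f))\<^sup>2 * t)) * character (?v f) z)"
    unfolding box_kernel_def lattice_box_eq_image by (subst sum.reindex[OF inj]) simp
  also have "\<dots> = (\<Sum>f\<in>UNIV \<rightarrow>\<^sub>E {- int M..int M}.
      \<Prod>i\<in>UNIV. cis (2 * pi * (of_int (f i) * z $ i + (of_int (f i))\<^sup>2 * t)))"
    by (simp only: phase_eq)
  also have "\<dots> = (\<Prod>i\<in>UNIV. weyl_sum M t (z $ i))"
    unfolding weyl_sum_def by (rule prod_sum_PiE[symmetric]) auto
  finally show ?thesis .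
qed

lemma lattice_norm_square_Ints:
  assumes "\<And>i. k $ i \<in> \<int>"
  shows "(norm (k :: real ^ 'd))\<^sup>2 \<in> \<int>"
  using assms by (auto simp: power2_norm_eq_inner inner_vec_def intro!: Ints_sum Ints_mult)

lemma lattice_sphere_subset_box:
  assumes "0 \<le> N"
  shows "lattice_sphere N \<subseteq> (lattice_box (nat \<lfloor>N\<rfloor>) :: (real ^ 'd) set)"
proof
  fix k :: "real ^ 'd" assume k: "k \<in> lattice_sphere N"
  have "\<bar>k $ i\<bar> \<le> real (nat \<lfloor>N\<rfloor>)" for i
  proof -
    obtain n where n: "k $ i = of_int n" using k by (auto simp: lattice_sphere_def elim: Ints_cases)
    have "\<bar>k $ i\<bar> \<le> N" using component_le_norm_cart[of k i] k by (simp add: lattice_sphere_def)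
    then have "\<bar>n\<bar> \<le> \<lfloor>N\<rfloor>" unfolding n by (simp add: le_floor_iff)
    then show ?thesis using assms unfolding n by simp
  qed
  then show "k \<in> lattice_box (nat \<lfloor>N\<rfloor>)" using k by (auto simp: lattice_box_def lattice_sphere_def)
qed

text \<open>
  The circle method: \<open>\<bar>k\<bar>\<^sup>2 - N\<^sup>2\<close> is an integer, so integration in \<open>t\<close> over a period keeps the
  frequencies of length \<open>N\<close> and removes all others.
\<close>

lemma has_integral_sphere_extraction:
  fixes v :: "real ^ 'd \<Rightarrow> complex"
  assumes N: "0 \<le> N" "N\<^sup>2 \<in> \<int>"
  shows "((\<lambda>t. (\<Sum>k\<in>lattice_box (nat \<lfloor>N\<rfloor>). v k * cis (2 * pi * ((norm k)\<^sup>2 * t))) * cis (- (2 * pi * (N\<^sup>2 * t))))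
          has_integral (\<Sum>k\<in>lattice_sphere N. v k)) {0..1}"
proof -
  let ?B = "lattice_box (nat \<lfloor>N\<rfloor>) :: (real ^ 'd) set"
  have subset: "lattice_sphere N \<subseteq> ?B" by (rule lattice_sphere_subset_box[OF N(1)])
  have "((\<lambda>t. v k * cis (2 * pi * (((norm k)\<^sup>2 - N\<^sup>2) * t))) has_integral
      (if k \<in> lattice_sphere N then v k else 0)) {0..1}" if k: "k \<in> ?B" for k
  proof -
    have ki: "\<And>i. k $ i \<in> \<int>" using k by (simp add: lattice_box_def)
    then obtain n where n: "(norm k)\<^sup>2 - N\<^sup>2 = of_int n"
      using N(2) lattice_norm_square_Ints[of k] by (metis Ints_cases Ints_diff)
    have "n = 0 \<longleftrightarrow> (norm k)\<^sup>2 = N\<^sup>2" using n by auto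
    also have "\<dots> \<longleftrightarrow> k \<in> lattice_sphere N"
      using N(1) ki by (simp add: lattice_sphere_def)
    finally show ?thesis
      using has_integral_mult_right[OF has_integral_cis[of n], of "v k"] by (auto simp: n)
  qed
  then have "((\<lambda>t. \<Sum>k\<in>?B. v k * cis (2 * pi * (((norm k)\<^sup>2 - N\<^sup>2) * t))) has_integral
      (\<Sum>k\<in>?B. if k \<in> lattice_sphere N then v k else 0)) {0..1}"
    by (intro has_integral_sum finite_lattice_box)
  moreover have "(\<Sum>k\<in>?B. if k \<in> lattice_sphere N then v k else 0) = (\<Sum>k\<in>lattice_sphere N. v k)"
    using subset
    by (subst sum.inter_restrict[symmetric]) (auto simp: finite_lattice_box Int_absorb1)
  moreover have "(\<Sum>k\<in>?B. v k * cis (2 * pi * (((norm k)\<^sup>2 - N\<^sup>2) * t)))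
      = (\<Sum>k\<in>?B. v k * cis (2 * pi * ((norm k)\<^sup>2 * t))) * cis (- (2 * pi * (N\<^sup>2 * t)))" for t
    unfolding sum_distrib_right
    by (intro sum.cong refl) (simp add: cis_mult mult.assoc algebra_simps)
  ultimately show ?thesis by simp
qed

text \<open>
  Two bounds for the quadratic form \<open>T t = (\<Sum>k. v k * cis (2\<pi>t\<bar>k\<bar>\<^sup>2))\<close> are interpolated at each \<open>t\<close>:
  the uniform one by \<open>X\<close> to the power \<open>1 - \<sigma>\<close>, and the one by \<open>Y\<close> times the supremum of the
  kernel to the power \<open>\<sigma>\<close>. The kernel is a product of \<open>d\<close> Weyl sums, hence the moment that
  arises after integration in \<open>t\<close> is the one of order \<open>d * \<sigma>\<close>. Interpolating pointwise, before
  integrating, takes the place of an interpolation theorem for operators.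

  The weights \<open>v\<close> are left open, because the same bound with \<open>\<sigma> = 1\<close> and \<open>v = 1\<close> counts the
  lattice points on the sphere.
\<close>

lemma lattice_sphere_sum_bound:
  assumes \<sigma>: "4 < real CARD('d) * \<sigma>" "\<sigma> \<le> 1"
  shows "\<exists>C>0. \<forall>N X Y. \<forall>v :: real ^ 'd \<Rightarrow> complex.
     1 \<le> N \<longrightarrow> N\<^sup>2 \<in> \<int> \<longrightarrow> 0 < X \<longrightarrow> 0 \<le> Y \<longrightarrow>
     (\<forall>t. norm (\<Sum>k\<in>lattice_box (nat \<lfloor>N\<rfloor>). v k * cis (2 * pi * ((norm k)\<^sup>2 * t))) \<le> X) \<longrightarrow>
     (\<forall>t B. (\<forall>z :: real ^ 'd. norm (box_kernel (nat \<lfloor>N\<rfloor>) t z) \<le> B) \<longrightarrow>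
        norm (\<Sum>k\<in>lattice_box (nat \<lfloor>N\<rfloor>). v k * cis (2 * pi * ((norm k)\<^sup>2 * t))) \<le> Y * B) \<longrightarrow>
     norm (\<Sum>k\<in>lattice_sphere N. v k) \<le> C * X powr (1 - \<sigma>) * Y powr \<sigma> * N powr (real CARD('d) * \<sigma> - 2)"
proof -
  let ?d = "real CARD('d)"
  have s0: "0 < \<sigma>" using \<sigma>(1) by (metis mult_nonneg_nonpos not_le of_nat_0_le_iff order.strict_trans zero_less_numeral)
  obtain C where C: "0 < C" and CG: "\<And>M. 1 \<le> M \<Longrightarrow> \<exists>G. continuous_on {0..1} G \<and>
           integral {0..1} G \<le> C * real M powr (?d * \<sigma> - 2) \<and>
           (\<forall>t\<in>{0..1}. \<forall>x. norm (weyl_sum M t x) powr (?d * \<sigma>) \<le> G t)"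
    using weyl_sum_maximal_moment[OF \<sigma>(1)] by blast
  show ?thesis
  proof (intro exI[of _ C] conjI C allI impI)
    fix N X Y :: real and v :: "real ^ 'd \<Rightarrow> complex"
    assume N: "1 \<le> N" "N\<^sup>2 \<in> \<int>" and X: "0 < X" and Y: "0 \<le> Y"
    define M where "M = nat \<lfloor>N\<rfloor>"
    define T where "T t = (\<Sum>k\<in>lattice_box M. v k * cis (2 * pi * ((norm k)\<^sup>2 * t)))" for t
    assume "\<forall>t. norm (\<Sum>k\<in>lattice_box (nat \<lfloor>N\<rfloor>). v k * cis (2 * pi * ((norm k)\<^sup>2 * t))) \<le> X"
    then have TX: "norm (T t) \<le> X" for t by (simp add: T_def M_def)
    assume "\<forall>t B. (\<forall>z :: real ^ 'd. norm (box_kernel (nat \<lfloor>N\<rfloor>) t z) \<le> B) \<longrightarrow>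
        norm (\<Sum>k\<in>lattice_box (nat \<lfloor>N\<rfloor>). v k * cis (2 * pi * ((norm k)\<^sup>2 * t))) \<le> Y * B"
    then have TY: "norm (T t) \<le> Y * B" if "\<And>z :: real ^ 'd. norm (box_kernel M t z) \<le> B" for t B
      using that by (simp add: T_def M_def)
    have M1: "1 \<le> M" and MN: "real M \<le> N" using N(1) by (auto simp: M_def le_nat_iff le_floor_iff)
    obtain G where G: "continuous_on {0..1} G" "integral {0..1} G \<le> C * real M powr (?d * \<sigma> - 2)"
        "\<And>t x. t \<in> {0..1} \<Longrightarrow> norm (weyl_sum M t x) powr (?d * \<sigma>) \<le> G t"
      using CG[OF M1] by blast
    have bound: "norm (T t) \<le> X powr (1 - \<sigma>) * Y powr \<sigma> * G t" if t: "t \<in> {0..1}" for t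
    proof -
      have G0: "0 \<le> G t" using G(3)[OF t] powr_ge_zero order_trans by blast
      have "norm (box_kernel M t z) \<le> G t powr (1 / \<sigma>)" for z :: "real ^ 'd"
      proof -
        have "norm (weyl_sum M t x) \<le> G t powr (1 / (?d * \<sigma>))" for x
        proof -
          have "(norm (weyl_sum M t x) powr (?d * \<sigma>)) powr (1 / (?d * \<sigma>)) \<le> G t powr (1 / (?d * \<sigma>))"
            using G(3)[OF t] s0 by (intro powr_mono2) auto
          then show ?thesis using s0 by (simp add: powr_powr)
        qed
        then have "norm (box_kernel M t z) \<le> (\<Prod>i\<in>(UNIV::'d set). G t powr (1 / (?d * \<sigma>)))"
          unfolding box_kernel_eq_prod prod_norm[symmetric] by (intro prod_mono) auto
        also have "\<dots> = (G t powr (1 / (?d * \<sigma>))) powr ?d"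
          by (simp add: powr_realpow') 
        also have "\<dots> = G t powr (1 / \<sigma>)" by (simp add: powr_powr)
        finally show ?thesis .
      qed
      then have "norm (T t) \<le> Y * G t powr (1 / \<sigma>)" by (rule TY)
      then have "norm (T t) powr \<sigma> \<le> (Y * G t powr (1 / \<sigma>)) powr \<sigma>"
        using s0 by (intro powr_mono2) auto
      also have "\<dots> = Y powr \<sigma> * G t" using s0 G0 Y by (simp add: powr_mult powr_powr)
      finally have "norm (T t) powr (1 - \<sigma>) * norm (T t) powr \<sigma> \<le> X powr (1 - \<sigma>) * (Y powr \<sigma> * G t)"
        using \<sigma>(2) by (intro mult_mono powr_mono2 TX) auto
      then show ?thesis by (simp add: mult.assoc flip: powr_add)
    qed
    have hi: "((\<lambda>t. T t * cis (- (2 * pi * (N\<^sup>2 * t)))) has_integral (\<Sum>k\<in>lattice_sphere N. v k)) {0..1}"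
      unfolding T_def M_def using N by (intro has_integral_sphere_extraction) auto
    have "norm (\<Sum>k\<in>lattice_sphere N. v k) = norm (integral {0..1} (\<lambda>t. T t * cis (- (2 * pi * (N\<^sup>2 * t)))))"
      using hi by (simp add: integral_unique)
    also have "\<dots> \<le> integral {0..1} (\<lambda>t. X powr (1 - \<sigma>) * Y powr \<sigma> * G t)"
    proof (rule integral_norm_bound_integral)
      show "(\<lambda>t. T t * cis (- (2 * pi * (N\<^sup>2 * t)))) integrable_on {0..1}" using hi by blast
      show "(\<lambda>t. X powr (1 - \<sigma>) * Y powr \<sigma> * G t) integrable_on {0..1}"
        by (intro integrable_continuous_real continuous_intros G(1))
      fix t :: real assume "t \<in> {0..1}"
      then show "norm (T t * cis (- (2 * pi * (N\<^sup>2 * t)))) \<le> X powr (1 - \<sigma>) * Y powr \<sigma> * G t"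
        using bound by (simp add: norm_mult)
    qed
    also have "\<dots> = X powr (1 - \<sigma>) * Y powr \<sigma> * integral {0..1} G" by (rule integral_mult_right)
    also have "\<dots> \<le> X powr (1 - \<sigma>) * Y powr \<sigma> * (C * N powr (?d * \<sigma> - 2))"
    proof (intro mult_left_mono)
      have "real M powr (?d * \<sigma> - 2) \<le> N powr (?d * \<sigma> - 2)"
        using \<sigma>(1) MN by (intro powr_mono2) auto
      then have "C * real M powr (?d * \<sigma> - 2) \<le> C * N powr (?d * \<sigma> - 2)" using C by simp
      then show "integral {0..1} G \<le> C * N powr (?d * \<sigma> - 2)" using G(2) by linarith
    qed auto
    finally show "norm (\<Sum>k\<in>lattice_sphere N. v k)
        \<le> C * X powr (1 - \<sigma>) * Y powr \<sigma> * N powr (?d * \<sigma> - 2)"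
      by (simp add: mult_ac)
  qed
qed

section \<open>Level sets of eigenfunctions\<close>

text \<open>
  Undoing both Fourier coefficients shows that the quadratic form is the double integral of
  \<open>g x * cnj (g y)\<close> against the kernel at \<open>y - x\<close>. It is treated as an iterated integral, so that only
  finite sums have to be interchanged with integrals.
\<close>

lemma fourier_quadratic_form_bound:
  fixes g :: "real ^ 'd \<Rightarrow> complex"
  assumes g [measurable]: "g \<in> borel_measurable torus" and bd: "\<And>x. norm (g x) \<le> 1"
    and B: "\<And>z :: real ^ 'd. norm (box_kernel M t z) \<le> B"
  shows "norm (\<Sum>k\<in>lattice_box M. of_real ((norm (fourier_coeff g k))\<^sup>2) * cis (2 * pi * ((norm k)\<^sup>2 * t)))
           \<le> (\<integral>x. norm (g x) \<partial>torus)\<^sup>2 * B"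
proof -
  define m where "m = (\<integral>x. norm (g x) \<partial>torus)"
  define c where "c k = cis (2 * pi * ((norm k)\<^sup>2 * t))" for k :: "real ^ 'd"
  define F where "F x = (\<Sum>k\<in>lattice_box M. c k * cnj (fourier_coeff g k) * cnj (character k x))" for x
  have B0: "0 \<le> B" using B norm_ge_zero order_trans by blast
  have ig: "integrable torus (\<lambda>x. norm (g x))"
    using bd by (intro integrable_torus_bounded[where B = 1]) auto
  have Fm [measurable]: "F \<in> borel_measurable torus" unfolding F_def by measurable
  have F: "norm (F x) \<le> m * B" for x
  proof -
    have cc: "cnj (fourier_coeff g k) = (\<integral>y. cnj (g y) * character k y \<partial>torus)" for k
    proof -
      have "cnj (fourier_coeff g k) = (\<integral>y. cnj (g y * cnj (character k y)) \<partial>torus)"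
        unfolding fourier_coeff_def by (rule Bochner_Integration.integral_cnj[symmetric])
      then show ?thesis by simp
    qed
    have "F x = (\<Sum>k\<in>lattice_box M. \<integral>y. (c k * cnj (character k x)) * (cnj (g y) * character k y) \<partial>torus)"
      unfolding F_def cc integral_mult_right_zero by (intro sum.cong refl) (simp only: mult_ac)
    also have "\<dots> = (\<integral>y. (\<Sum>k\<in>lattice_box M. (c k * cnj (character k x)) * (cnj (g y) * character k y)) \<partial>torus)"
      using bd by (intro Bochner_Integration.integral_sum[symmetric] integrable_torus_bounded[where B = 1])
        (auto simp: norm_mult c_def)
    also have "\<dots> = (\<integral>y. cnj (g y) * box_kernel M t (y - x) \<partial>torus)"
    proof (intro Bochner_Integration.integral_cong refl)
      fix y
      have "character k (y - x) = cnj (character k x) * character k y" for k :: "real ^ 'd"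
        by (simp add: character_def cis_cnj cis_mult inner_diff_right algebra_simps)
      then show "(\<Sum>k\<in>lattice_box M. (c k * cnj (character k x)) * (cnj (g y) * character k y))
          = cnj (g y) * box_kernel M t (y - x)"
        by (simp add: box_kernel_def c_def sum_distrib_left mult_ac)
    qed
    finally have "norm (F x) \<le> (\<integral>y. norm (cnj (g y) * box_kernel M t (y - x)) \<partial>torus)"
      by simp
    also have "\<dots> \<le> (\<integral>y. norm (g y) * B \<partial>torus)"
      using B by (intro integral_mono' integrable_mult_left ig) (auto simp: norm_mult B0 intro!: mult_left_mono)
    finally show ?thesis by (simp add: m_def)
  qed
  have "(\<Sum>k\<in>lattice_box M. of_real ((norm (fourier_coeff g k))\<^sup>2) * c k)
      = (\<Sum>k\<in>lattice_box M. \<integral>x. c k * cnj (fourier_coeff g k) * (g x * cnj (character k x)) \<partial>torus)"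
    unfolding complex_norm_square integral_mult_right_zero fourier_coeff_def[symmetric]
    by (simp only: mult_ac)
  also have "\<dots> = (\<integral>x. (\<Sum>k\<in>lattice_box M. c k * cnj (fourier_coeff g k) * (g x * cnj (character k x))) \<partial>torus)"
    using bd by (intro Bochner_Integration.integral_sum[symmetric] integrable_mult_right integrable_torus_bounded[where B = 1])
      (auto simp: norm_mult)
  also have "\<dots> = (\<integral>x. g x * F x \<partial>torus)"
    by (intro Bochner_Integration.integral_cong refl) (simp add: F_def sum_distrib_left mult_ac)
  finally have "norm (\<Sum>k\<in>lattice_box M. of_real ((norm (fourier_coeff g k))\<^sup>2) * c k)
      \<le> (\<integral>x. norm (g x * F x) \<partial>torus)" by simp
  also have "\<dots> \<le> (\<integral>x. norm (g x) * (m * B) \<partial>torus)"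
    using F order_trans[OF norm_ge_zero F]
    by (intro integral_mono' integrable_mult_left ig) (auto simp: norm_mult intro!: mult_left_mono)
  also have "\<dots> = m * (m * B)" by (simp add: m_def)
  finally show ?thesis by (simp add: m_def c_def power2_eq_square mult.assoc)
qed

text \<open>
  For \<open>\<bar>g\<bar> \<le> 1\<close> with \<open>m = \<integral>\<bar>g\<bar>\<close>, Bessel's inequality supplies the bound \<open>X = m\<close>, because
  \<open>\<bar>g\<bar>\<^sup>2 \<le> \<bar>g\<bar>\<close>, and the kernel supplies \<open>Y = m\<^sup>2\<close>. Their interpolation is the power
  \<open>(1 - \<sigma>) + 2\<sigma> = 1 + \<sigma>\<close> of \<open>m\<close>.
\<close>

lemma sphere_coefficients_bound:
  assumes \<sigma>: "4 < real CARD('d) * \<sigma>" "\<sigma> \<le> 1"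
  shows "\<exists>C>0. \<forall>N. \<forall>g :: real ^ 'd \<Rightarrow> complex. 1 \<le> N \<longrightarrow> N\<^sup>2 \<in> \<int> \<longrightarrow>
     g \<in> borel_measurable torus \<longrightarrow> (\<forall>x. norm (g x) \<le> 1) \<longrightarrow> 0 < (\<integral>x. norm (g x) \<partial>torus) \<longrightarrow>
     (\<Sum>k\<in>lattice_sphere N. (norm (fourier_coeff g k))\<^sup>2)
       \<le> C * (\<integral>x. norm (g x) \<partial>torus) powr (1 + \<sigma>) * N powr (real CARD('d) * \<sigma> - 2)"
proof -
  obtain C where C: "0 < C" and bound: "\<And>N X Y. \<And>v :: real ^ 'd \<Rightarrow> complex.
     1 \<le> N \<Longrightarrow> N\<^sup>2 \<in> \<int> \<Longrightarrow> 0 < X \<Longrightarrow> 0 \<le> Y \<Longrightarrow>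
     (\<And>t. norm (\<Sum>k\<in>lattice_box (nat \<lfloor>N\<rfloor>). v k * cis (2 * pi * ((norm k)\<^sup>2 * t))) \<le> X) \<Longrightarrow>
     (\<And>t B. (\<And>z :: real ^ 'd. norm (box_kernel (nat \<lfloor>N\<rfloor>) t z) \<le> B) \<Longrightarrow>
        norm (\<Sum>k\<in>lattice_box (nat \<lfloor>N\<rfloor>). v k * cis (2 * pi * ((norm k)\<^sup>2 * t))) \<le> Y * B) \<Longrightarrow>
     norm (\<Sum>k\<in>lattice_sphere N. v k) \<le> C * X powr (1 - \<sigma>) * Y powr \<sigma> * N powr (real CARD('d) * \<sigma> - 2)"
    using lattice_sphere_sum_bound[OF \<sigma>] by meson
  show ?thesis
  proof (intro exI[of _ C] conjI C allI impI)
    fix N :: real and g :: "real ^ 'd \<Rightarrow> complex"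
    assume N: "1 \<le> N" "N\<^sup>2 \<in> \<int>" and g: "g \<in> borel_measurable torus" and g1: "\<forall>x. norm (g x) \<le> 1"
      and m0: "0 < (\<integral>x. norm (g x) \<partial>torus)"
    define m where "m = (\<integral>x. norm (g x) \<partial>torus)"
    define v :: "real ^ 'd \<Rightarrow> complex" where "v k = of_real ((norm (fourier_coeff g k))\<^sup>2)" for k
    let ?T = "\<lambda>t. \<Sum>k\<in>lattice_box (nat \<lfloor>N\<rfloor>). v k * cis (2 * pi * ((norm k)\<^sup>2 * t))"
    have "norm (?T t) \<le> m" for t
    proof -
      have "norm (?T t) \<le> (\<Sum>k\<in>lattice_box (nat \<lfloor>N\<rfloor>). (norm (fourier_coeff g k))\<^sup>2)"
        by (rule sum_norm_le) (simp add: v_def norm_mult norm_power)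
      also have "\<dots> \<le> (\<integral>x. (norm (g x))\<^sup>2 \<partial>torus)"
        using g1 by (intro bessel_inequality[OF finite_lattice_box _ g, where B = 1]) (auto simp: lattice_box_def)
      also have "\<dots> \<le> m"
        unfolding m_def using g g1
        by (intro integral_mono' integrable_torus_bounded[where B = 1])
           (auto simp: power2_eq_square mult_left_le)
      finally show ?thesis .
    qed
    moreover have "norm (?T t) \<le> m\<^sup>2 * B" if "\<And>z :: real ^ 'd. norm (box_kernel (nat \<lfloor>N\<rfloor>) t z) \<le> B" for t B
      unfolding v_def m_def using g g1 that by (intro fourier_quadratic_form_bound) auto
    ultimately have "norm (\<Sum>k\<in>lattice_sphere N. v k)
        \<le> C * m powr (1 - \<sigma>) * m\<^sup>2 powr \<sigma> * N powr (real CARD('d) * \<sigma> - 2)"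
      using N m0 by (intro bound) (auto simp: m_def)
    also have "(\<Sum>k\<in>lattice_sphere N. v k) = of_real (\<Sum>k\<in>lattice_sphere N. (norm (fourier_coeff g k))\<^sup>2)"
      by (simp add: v_def)
    also have "norm \<dots> = (\<Sum>k\<in>lattice_sphere N. (norm (fourier_coeff g k))\<^sup>2)"
      unfolding norm_of_real by (intro abs_of_nonneg sum_nonneg) simp
    also have "C * m powr (1 - \<sigma>) * m\<^sup>2 powr \<sigma> = C * m powr (1 + \<sigma>)"
    proof -
      have "m\<^sup>2 powr \<sigma> = m powr (2 * \<sigma>)"
        using m0 by (simp add: m_def powr_powr flip: powr_numeral)
      then show ?thesis by (simp add: mult.assoc add.commute flip: powr_add)
    qed
    finally show "(\<Sum>k\<in>lattice_sphere N. (norm (fourier_coeff g k))\<^sup>2)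
       \<le> C * (\<integral>x. norm (g x) \<partial>torus) powr (1 + \<sigma>) * N powr (real CARD('d) * \<sigma> - 2)"
      by (simp add: m_def)
  qed
qed

text \<open>
  All weights are 1 and the quadratic form is the kernel itself at the origin. This is the endpoint
  \<open>\<sigma> = 1\<close>, which needs \<open>d > 4\<close> and corresponds to \<open>p = \<infinity>\<close>.
\<close>

lemma card_lattice_sphere_bound:
  assumes "5 \<le> CARD('d)"
  shows "\<exists>C>0. \<forall>N. 1 \<le> N \<longrightarrow> N\<^sup>2 \<in> \<int> \<longrightarrow>
     real (card (lattice_sphere N :: (real ^ 'd) set)) \<le> C * N powr (real CARD('d) - 2)"
proof -
  have \<sigma>: "4 < real CARD('d) * 1" "(1::real) \<le> 1" using assms by auto
  obtain C where C: "0 < C" and bound: "\<And>N X Y. \<And>v :: real ^ 'd \<Rightarrow> complex.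
     1 \<le> N \<Longrightarrow> N\<^sup>2 \<in> \<int> \<Longrightarrow> 0 < X \<Longrightarrow> 0 \<le> Y \<Longrightarrow>
     (\<And>t. norm (\<Sum>k\<in>lattice_box (nat \<lfloor>N\<rfloor>). v k * cis (2 * pi * ((norm k)\<^sup>2 * t))) \<le> X) \<Longrightarrow>
     (\<And>t B. (\<And>z :: real ^ 'd. norm (box_kernel (nat \<lfloor>N\<rfloor>) t z) \<le> B) \<Longrightarrow>
        norm (\<Sum>k\<in>lattice_box (nat \<lfloor>N\<rfloor>). v k * cis (2 * pi * ((norm k)\<^sup>2 * t))) \<le> Y * B) \<Longrightarrow>
     norm (\<Sum>k\<in>lattice_sphere N. v k) \<le> C * X powr (1 - 1) * Y powr 1 * N powr (real CARD('d) * 1 - 2)"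
    using lattice_sphere_sum_bound[OF \<sigma>] by meson
  show ?thesis
  proof (intro exI[of _ C] conjI C allI impI)
    fix N :: real assume N: "1 \<le> N" "N\<^sup>2 \<in> \<int>"
    let ?X = "real (card (lattice_box (nat \<lfloor>N\<rfloor>) :: (real ^ 'd) set)) + 1"
    have "norm (\<Sum>k\<in>(lattice_sphere N :: (real ^ 'd) set). 1 :: complex)
        \<le> C * ?X powr (1 - 1) * 1 powr 1 * N powr (real CARD('d) * 1 - 2)"
    proof (rule bound[OF N])
      fix t
      have "norm (\<Sum>k\<in>(lattice_box (nat \<lfloor>N\<rfloor>) :: (real ^ 'd) set). 1 * cis (2 * pi * ((norm k)\<^sup>2 * t)))
          \<le> (\<Sum>k\<in>(lattice_box (nat \<lfloor>N\<rfloor>) :: (real ^ 'd) set). 1)"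
        by (rule sum_norm_le) simp
      then show "norm (\<Sum>k\<in>(lattice_box (nat \<lfloor>N\<rfloor>) :: (real ^ 'd) set). 1 * cis (2 * pi * ((norm k)\<^sup>2 * t))) \<le> ?X"
        by simp
    next
      fix t B assume "\<And>z :: real ^ 'd. norm (box_kernel (nat \<lfloor>N\<rfloor>) t z) \<le> B"
      from this[of 0]
      show "norm (\<Sum>k\<in>(lattice_box (nat \<lfloor>N\<rfloor>) :: (real ^ 'd) set). 1 * cis (2 * pi * ((norm k)\<^sup>2 * t))) \<le> 1 * B"
        by (simp add: box_kernel_def character_def)
    qed auto
    then show "real (card (lattice_sphere N :: (real ^ 'd) set)) \<le> C * N powr (real CARD('d) - 2)"
      by simp
  qed
qed

text \<open>
  Duality: testing the eigenfunction \<open>f\<close> against the phase \<open>g\<close> of \<open>f\<close> on its level set \<open>E\<close> gives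
  \<open>l * \<bar>E\<bar> \<le> \<bar>\<integral> f * cnj g\<bar>\<close>, and by Cauchy-Schwarz the square of the right-hand side is at most
  \<open>\<parallel>f\<parallel>\<^sub>2\<^sup>2\<close> times the sum of the squared coefficients of \<open>g\<close> on the sphere. That sum grows like
  \<open>\<bar>E\<bar> powr (1 + \<sigma>)\<close> with \<open>\<sigma> < 1\<close>, and dividing by this power leaves a bound for \<open>\<bar>E\<bar>\<close>.
\<close>

lemma level_set_bound:
  assumes \<sigma>: "4 < real CARD('d) * \<sigma>" "\<sigma> < 1"
  shows "\<exists>C>0. \<forall>N l. \<forall>a :: real ^ 'd \<Rightarrow> complex. 1 \<le> N \<longrightarrow> N\<^sup>2 \<in> \<int> \<longrightarrow> 0 < l \<longrightarrow>
     l\<^sup>2 * measure torus {x \<in> space torus. l < norm (\<Sum>k\<in>lattice_sphere N. a k * character k x)} powr (1 - \<sigma>)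
       \<le> C * (\<Sum>k\<in>lattice_sphere N. (norm (a k))\<^sup>2) * N powr (real CARD('d) * \<sigma> - 2)"
proof -
  obtain C where C: "0 < C" and bound: "\<And>N. \<And>g :: real ^ 'd \<Rightarrow> complex. 1 \<le> N \<Longrightarrow> N\<^sup>2 \<in> \<int> \<Longrightarrow>
     g \<in> borel_measurable torus \<Longrightarrow> (\<And>x. norm (g x) \<le> 1) \<Longrightarrow> 0 < (\<integral>x. norm (g x) \<partial>torus) \<Longrightarrow>
     (\<Sum>k\<in>lattice_sphere N. (norm (fourier_coeff g k))\<^sup>2)
       \<le> C * (\<integral>x. norm (g x) \<partial>torus) powr (1 + \<sigma>) * N powr (real CARD('d) * \<sigma> - 2)"
    using sphere_coefficients_bound[OF \<sigma>(1) less_imp_le[OF \<sigma>(2)]] by meson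
  show ?thesis
  proof (intro exI[of _ C] conjI C allI impI)
    fix N l :: real and a :: "real ^ 'd \<Rightarrow> complex"
    assume N: "1 \<le> N" "N\<^sup>2 \<in> \<int>" and l: "0 < l"
    let ?S = "lattice_sphere N :: (real ^ 'd) set"
    define f where "f x = (\<Sum>k\<in>?S. a k * character k x)" for x
    have fm [measurable]: "f \<in> borel_measurable torus" unfolding f_def by measurable
    define E where "E = {x \<in> space torus. l < norm (f x)}"
    have Em [measurable]: "E \<in> sets torus" unfolding E_def by measurable
    have E_space: "E \<inter> cbox 0 1 = E" by (auto simp: E_def)
    define m where "m = measure torus E"
    define A2 where "A2 = (\<Sum>k\<in>?S. (norm (a k))\<^sup>2)"
    define g where "g x = indicator E x *\<^sub>R (f x / of_real (norm (f x)))" for x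
    have gm [measurable]: "g \<in> borel_measurable torus" unfolding g_def by measurable
    have g1: "norm (g x) \<le> 1" for x by (auto simp: g_def indicator_def norm_divide)
    have "(\<integral>x. norm (g x) \<partial>torus) = (\<integral>x. indicator E x \<partial>torus)"
      using l by (intro Bochner_Integration.integral_cong refl) (auto simp: g_def E_def indicator_def norm_divide)
    also have "\<dots> = m" by (simp add: m_def E_space)
    finally have gint: "(\<integral>x. norm (g x) \<partial>torus) = m" .
    have fb: "norm (f x) \<le> (\<Sum>k\<in>?S. norm (a k))" for x
      unfolding f_def by (rule sum_norm_le) (simp add: norm_mult)
    have "l * m = (\<integral>x. l * indicator E x \<partial>torus)" by (simp add: m_def E_space)
    also have "\<dots> \<le> (\<integral>x. indicator E x * norm (f x) \<partial>torus)"
    proof (intro integral_mono')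
      show "integrable torus (\<lambda>x. indicator E x * norm (f x))"
        using fb by (intro integrable_torus_bounded[where B = "\<Sum>k\<in>?S. norm (a k)"])
          (auto simp: indicator_def sum_nonneg)
    qed (auto simp: E_def indicator_def)
    also have "\<dots> = norm (complex_of_real (\<integral>x. indicator E x * norm (f x) \<partial>torus))"
      by (simp add: integral_nonneg_AE)
    also have "complex_of_real (\<integral>x. indicator E x * norm (f x) \<partial>torus) = (\<integral>x. f x * cnj (g x) \<partial>torus)"
      unfolding integral_complex_of_real[symmetric]
    proof (intro Bochner_Integration.integral_cong refl)
      fix x
      show "complex_of_real (indicator E x * norm (f x)) = f x * cnj (g x)"
        using complex_norm_square[of "f x"]
        by (cases "f x = 0") (auto simp: g_def indicator_def power2_eq_square divide_simps)
    qed
    also have "\<dots> = (\<integral>x. (\<Sum>k\<in>?S. a k * cnj (g x * cnj (character k x))) \<partial>torus)"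
      by (intro Bochner_Integration.integral_cong refl) (simp add: f_def sum_distrib_left mult_ac)
    also have "\<dots> = (\<Sum>k\<in>?S. \<integral>x. a k * cnj (g x * cnj (character k x)) \<partial>torus)"
      using g1 by (intro Bochner_Integration.integral_sum integrable_mult_right integrable_torus_bounded[where B = 1])
        (auto simp: norm_mult)
    also have "\<dots> = (\<Sum>k\<in>?S. a k * cnj (fourier_coeff g k))"
      unfolding fourier_coeff_def by (simp only: integral_mult_right_zero Bochner_Integration.integral_cnj)
    also have "norm \<dots> \<le> (\<Sum>k\<in>?S. norm (a k) * norm (fourier_coeff g k))"
      by (rule sum_norm_le) (simp add: norm_mult)
    finally have "l * m \<le> (\<Sum>k\<in>?S. norm (a k) * norm (fourier_coeff g k))" .
    then have "(l * m)\<^sup>2 \<le> (\<Sum>k\<in>?S. norm (a k) * norm (fourier_coeff g k))\<^sup>2"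
      using l by (intro power_mono) (auto simp: m_def)
    also have "\<dots> \<le> A2 * (\<Sum>k\<in>?S. (norm (fourier_coeff g k))\<^sup>2)"
      unfolding A2_def by (rule Cauchy_Schwarz_ineq_sum)
    finally have main: "(l * m)\<^sup>2 \<le> A2 * (\<Sum>k\<in>?S. (norm (fourier_coeff g k))\<^sup>2)" .
    have A20: "0 \<le> A2" by (simp add: A2_def sum_nonneg)
    have "l\<^sup>2 * m powr (1 - \<sigma>) \<le> C * A2 * N powr (real CARD('d) * \<sigma> - 2)"
    proof (cases "m = 0")
      case True
      then show ?thesis using C A20 by simp
    next
      case False
      then have m0: "0 < m" by (simp add: m_def zero_less_measure_iff)
      have "(l * m)\<^sup>2 \<le> A2 * (C * m powr (1 + \<sigma>) * N powr (real CARD('d) * \<sigma> - 2))"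
        using main mult_left_mono[OF bound[OF N gm g1] A20] gint m0 by (simp add: order_trans)
      also have "(l * m)\<^sup>2 = l\<^sup>2 * m powr (1 - \<sigma>) * m powr (1 + \<sigma>)"
        using m0 by (simp add: power_mult_distrib mult.assoc flip: powr_add)
      finally have "(l\<^sup>2 * m powr (1 - \<sigma>)) * m powr (1 + \<sigma>)
          \<le> (C * A2 * N powr (real CARD('d) * \<sigma> - 2)) * m powr (1 + \<sigma>)" by (simp add: mult_ac)
      then show ?thesis using m0 by (simp add: mult_le_cancel_right)
    qed
    then show "l\<^sup>2 * measure torus {x \<in> space torus. l < norm (\<Sum>k\<in>?S. a k * character k x)} powr (1 - \<sigma>)
       \<le> C * (\<Sum>k\<in>?S. (norm (a k))\<^sup>2) * N powr (real CARD('d) * \<sigma> - 2)"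
      by (simp add: m_def E_def f_def A2_def)
  qed
qed

section \<open>From level sets to the norm\<close>

text \<open>
  A bounded function that is of weak type \<open>s\<close> at the dyadic heights below its maximum is of strong
  type \<open>p > s\<close>. The heights \<open>H/2^j\<close> with \<open>j < J\<close> contribute a geometric series with ratio
  \<open>2 powr (s - p) < 1\<close>; the values below \<open>H/2^J\<close> are bounded trivially, and their contribution
  vanishes as \<open>J\<close> grows.
\<close>

lemma (in finite_measure) integral_powr_le_of_level_sets:
  fixes f :: "'a \<Rightarrow> real"
  assumes f [measurable]: "f \<in> borel_measurable M" and nn: "\<And>x. 0 \<le> f x" and fH: "\<And>x. f x \<le> H"
    and H: "0 < H" and K: "0 \<le> K" and sp: "s < p" "0 < p"
    and level: "\<And>j. measure M {x \<in> space M. H / 2 ^ j < f x} \<le> K * 2 powr (real j * s)"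
  shows "(\<integral>x. f x powr p \<partial>M) \<le> 2 powr s / (1 - 2 powr (s - p)) * (K * H powr p)"
proof -
  define E where "E j = {x \<in> space M. H / 2 ^ j < f x}" for j
  have Em [measurable]: "E j \<in> sets M" for j unfolding E_def by measurable
  define c where "c = (2::real) powr (s - p)"
  have c: "0 < c" "c < 1" using sp by (auto simp: c_def powr_less_one)
  define b where "b = (2::real) powr (-p)"
  have b: "0 \<le> b" "b < 1" using sp by (auto simp: b_def powr_less_one)
  have Hj: "(H / 2 ^ j) powr p = H powr p * b ^ j" for j
  proof -
    have "((2::real) ^ j) powr p = 2 powr (real j * p)"
      by (simp add: powr_powr flip: powr_realpow)
    moreover have "b ^ j = 2 powr (- (real j * p))"
      by (simp add: b_def powr_power mult.commute)
    ultimately show ?thesis unfolding powr_divide by (simp add: powr_minus divide_inverse)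
  qed
  have pointwise: "f x powr p \<le> (\<Sum>j<J. (H / 2 ^ j) powr p * indicator (E (Suc j)) x) + (H / 2 ^ J) powr p"
    if x: "x \<in> space M" for x J
  proof (induction J)
    case 0
    show ?case using nn fH sp by (simp add: powr_mono2)
  next
    case (Suc J)
    show ?case
    proof (cases "x \<in> E (Suc J)")
      case True
      then show ?thesis using Suc by (simp add: add_increasing2)
    next
      case False
      then have "f x \<le> H / 2 ^ Suc J" using x by (simp add: E_def)
      then have "f x powr p \<le> (H / 2 ^ Suc J) powr p" using nn sp by (intro powr_mono2) auto
      then show ?thesis by (intro add_increasing sum_nonneg) auto
    qed
  qed
  have partial: "(\<integral>x. f x powr p \<partial>M)
      \<le> 2 powr s / (1 - c) * (K * H powr p) + H powr p * measure M (space M) * b ^ J" for J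
  proof -
    have "(\<integral>x. f x powr p \<partial>M)
        \<le> (\<integral>x. (\<Sum>j<J. (H / 2 ^ j) powr p * indicator (E (Suc j)) x) + (H / 2 ^ J) powr p \<partial>M)"
      using pointwise
      by (intro integral_mono' Bochner_Integration.integrable_add Bochner_Integration.integrable_sum) (auto intro!: add_nonneg_nonneg sum_nonneg simp: emeasure_eq_measure)
    also have "\<dots> = (\<Sum>j<J. (H / 2 ^ j) powr p * measure M (E (Suc j))) + (H / 2 ^ J) powr p * measure M (space M)"
    proof -
      have E_space: "E j \<inter> space M = E j" for j by (auto simp: E_def)
      have i: "integrable M (\<lambda>x. (H / 2 ^ j) powr p * indicator (E (Suc j)) x)" for j
        by (intro integrable_mult_right) (auto simp: emeasure_eq_measure)
      have "(\<integral>x. (\<Sum>j<J. (H / 2 ^ j) powr p * indicator (E (Suc j)) x) + (H / 2 ^ J) powr p \<partial>M)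
          = (\<integral>x. (\<Sum>j<J. (H / 2 ^ j) powr p * indicator (E (Suc j)) x) \<partial>M) + (\<integral>x. (H / 2 ^ J) powr p \<partial>M)"
        by (rule Bochner_Integration.integral_add[OF Bochner_Integration.integrable_sum[OF i] integrable_const])
      also have "(\<integral>x. (\<Sum>j<J. (H / 2 ^ j) powr p * indicator (E (Suc j)) x) \<partial>M)
          = (\<Sum>j<J. \<integral>x. (H / 2 ^ j) powr p * indicator (E (Suc j)) x \<partial>M)"
        by (rule Bochner_Integration.integral_sum[OF i])
      finally show ?thesis by (simp add: E_space mult.commute)
    qed
    also have "(\<Sum>j<J. (H / 2 ^ j) powr p * measure M (E (Suc j)))
        \<le> (\<Sum>j<J. (H / 2 ^ j) powr p * (K * 2 powr (real (Suc j) * s)))"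
      unfolding E_def by (intro sum_mono mult_left_mono level) auto
    also have "\<dots> = (\<Sum>j<J. 2 powr s * (K * H powr p) * c ^ j)"
    proof (intro sum.cong refl)
      fix j
      have "b ^ j * 2 powr (real (Suc j) * s) = 2 powr s * c ^ j"
        by (simp add: b_def c_def powr_power flip: powr_add) (simp add: algebra_simps)
      then show "(H / 2 ^ j) powr p * (K * 2 powr (real (Suc j) * s)) = 2 powr s * (K * H powr p) * c ^ j"
        unfolding Hj by (simp add: mult_ac)
    qed
    also have "\<dots> = 2 powr s * (K * H powr p) * (\<Sum>j<J. c ^ j)"
      by (simp add: sum_distrib_left)
    also have "\<dots> \<le> 2 powr s * (K * H powr p) * (1 / (1 - c))"
    proof (intro mult_left_mono)
      show "(\<Sum>j<J. c ^ j) \<le> 1 / (1 - c)"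
        using c sum_le_suminf[OF summable_geometric, of c "{..<J}"] suminf_geometric[of c] by auto
    qed (use K in auto)
    finally show ?thesis unfolding Hj by (simp add: mult_ac)
  qed
  have "(\<lambda>J. 2 powr s / (1 - c) * (K * H powr p) + H powr p * measure M (space M) * b ^ J)
      \<longlonglongrightarrow> 2 powr s / (1 - c) * (K * H powr p) + H powr p * measure M (space M) * 0"
    using b by (intro tendsto_intros LIMSEQ_realpow_zero)
  then show ?thesis
    unfolding c_def[symmetric] using partial by (intro LIMSEQ_le_const) auto
qed

lemma exponential_eq_character:
  "exp (2 * of_real pi * \<i> * of_real (k \<bullet> x)) = character k x"
  by (simp add: character_def cis_conv_exp mult_ac)

theorem theorem1p2:
  fixes p :: real
  assumes "CARD('d::finite) \<ge> 5"
    and "p > 2 * real CARD('d) / (real CARD('d) - 4)"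
  shows "\<exists>C::real. \<forall>N::real. N > 0 \<and> N\<^sup>2 \<in> \<int> \<longrightarrow>
           (\<forall>e :: real ^ 'd \<Rightarrow> complex. torus_eigenfunction N e \<longrightarrow>
              torus_Lp_norm p e
                \<le> C * N powr ((real CARD('d) - 2) / 2 - real CARD('d) / p) * torus_Lp_norm 2 e)"
proof -
  define d where "d = real CARD('d)"
  have d: "5 \<le> d" using assms(1) by (simp add: d_def)
  have pd: "2 * d / (d - 4) < p" using assms(2) by (simp add: d_def)
  moreover have "0 < 2 * d / (d - 4)" using d by simp
  ultimately have p0: "0 < p" by linarith
  have "2 * d < p * (d - 4)" using pd d by (simp add: field_simps)
  then have "4 / d < 1 - 2 / p" using d p0 by (simp add: field_simps)
  \<comment> \<open>The lower bound on \<open>p\<close> leaves room for both constraints: the moment of order \<open>d * \<sigma>\<close> requires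
    \<open>\<sigma> > 4/d\<close>, and a weak-type exponent \<open>s = 2/(1 - \<sigma>)\<close> below \<open>p\<close> requires \<open>\<sigma> < 1 - 2/p\<close>.\<close>
  then obtain \<sigma> where \<sigma>: "4 / d < \<sigma>" "\<sigma> < 1 - 2 / p" using dense by blast
  have \<sigma>1: "\<sigma> < 1" using \<sigma>(2) p0 by (smt (verit) divide_pos_pos)
  have \<sigma>d: "4 < d * \<sigma>" using \<sigma>(1) d by (simp add: field_simps)
  define s where "s = 2 / (1 - \<sigma>)"
  have sp: "s < p" using \<sigma>(2) \<sigma>1 p0 by (simp add: s_def field_simps)
  obtain C1 where C1: "0 < C1" "\<And>N. 1 \<le> N \<Longrightarrow> N\<^sup>2 \<in> \<int> \<Longrightarrow>
     real (card (lattice_sphere N :: (real ^ 'd) set)) \<le> C1 * N powr (d - 2)"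
    unfolding d_def using card_lattice_sphere_bound[OF assms(1)] by blast
  obtain C2 where C2: "0 < C2" "\<And>N l. \<And>a :: real ^ 'd \<Rightarrow> complex. 1 \<le> N \<Longrightarrow> N\<^sup>2 \<in> \<int> \<Longrightarrow> 0 < l \<Longrightarrow>
     l\<^sup>2 * measure torus {x \<in> space torus. l < norm (\<Sum>k\<in>lattice_sphere N. a k * character k x)} powr (1 - \<sigma>)
       \<le> C2 * (\<Sum>k\<in>lattice_sphere N. (norm (a k))\<^sup>2) * N powr (d * \<sigma> - 2)"
    using level_set_bound[OF \<sigma>d[unfolded d_def] \<sigma>1] unfolding d_def by blast
  define C3 where "C3 = 2 powr s / (1 - 2 powr (s - p))"
  have C3: "0 < C3" using sp by (auto simp: C3_def powr_less_one)
  define C4 where "C4 = (C2 / C1) powr (1 / (1 - \<sigma>))"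
  have C4: "0 < C4" using C1 C2 by (simp add: C4_def)
  show ?thesis
  proof (intro exI[of _ "(C3 * C4) powr (1 / p) * sqrt C1"] allI impI)
    fix N :: real and e :: "real ^ 'd \<Rightarrow> complex"
    assume N: "N > 0 \<and> N\<^sup>2 \<in> \<int>" and "torus_eigenfunction N e"
    let ?S = "lattice_sphere N :: (real ^ 'd) set"
    obtain a where e: "e = (\<lambda>x. \<Sum>k\<in>?S. a k * character k x)"
      using \<open>torus_eigenfunction N e\<close> by (auto simp: torus_eigenfunction_def exponential_eq_character)
    have N1: "1 \<le> N"
    proof -
      obtain n where n: "N\<^sup>2 = of_int n" using N by (auto elim: Ints_cases)
      have "0 < N\<^sup>2" using N by simp
      then have "1 \<le> n" unfolding n by simp
      then have "1\<^sup>2 \<le> N\<^sup>2" unfolding n by simp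
      then show ?thesis using N by (intro power2_le_imp_le[of 1 N]) auto
    qed
    define A where "A = sqrt (\<Sum>k\<in>?S. (norm (a k))\<^sup>2)"
    have A2: "A\<^sup>2 = (\<Sum>k\<in>?S. (norm (a k))\<^sup>2)" by (simp add: A_def sum_nonneg)
    have A0: "0 \<le> A" by (simp add: A_def sum_nonneg)
    have L2: "torus_Lp_norm 2 e = A"
    proof -
      have "torus_Lp_norm 2 e = (\<integral>x. (norm (e x))\<^sup>2 \<partial>torus) powr (1 / 2)"
        by (simp add: torus_Lp_norm_def LINT_cube_eq_torus)
      also have "(\<integral>x. (norm (e x))\<^sup>2 \<partial>torus) = A\<^sup>2"
        unfolding e A2 by (rule parseval_trig_polynomial[OF finite_lattice_sphere]) (simp add: lattice_sphere_def)
      finally show ?thesis using A0 by (simp add: powr_half_sqrt)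
    qed
    have em: "(\<lambda>x. norm (e x)) \<in> borel_measurable torus" unfolding e by measurable
    show "torus_Lp_norm p e \<le> (C3 * C4) powr (1 / p) * sqrt C1
        * N powr ((real CARD('d) - 2) / 2 - real CARD('d) / p) * torus_Lp_norm 2 e"
    proof (cases "A = 0")
      case True
      then have "\<forall>k\<in>?S. a k = 0"
        using A2 by (simp add: sum_nonneg_eq_0_iff finite_lattice_sphere)
      then have "e x = 0" for x by (simp add: e)
      then have "torus_Lp_norm p e = 0" by (simp add: torus_Lp_norm_def LINT_cube_eq_torus p0)
      then show ?thesis using True L2 by simp
    next
      case False
      then have A: "0 < A" using A0 by simp
      \<comment> \<open>An upper bound for \<open>\<bar>e\<bar>\<close>, by Cauchy-Schwarz over the frequencies and the bound for their number.\<close>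
      define H where "H = A * (sqrt C1 * N powr ((d - 2) / 2))"
      have H: "0 < H" using A C1 N1 by (simp add: H_def)
      have H2: "H\<^sup>2 = A\<^sup>2 * (C1 * N powr (d - 2))"
      proof -
        have "(N powr ((d - 2) / 2))\<^sup>2 = N powr (d - 2)"
          by (simp add: power2_eq_square field_sum_of_halves flip: powr_add)
        then show ?thesis using C1 by (simp add: H_def power_mult_distrib)
      qed
      have eH: "norm (e x) \<le> H" for x
      proof (rule power2_le_imp_le)
        have "norm (e x) \<le> (\<Sum>k\<in>?S. norm (a k) * 1)"
          unfolding e by (rule sum_norm_le) (simp add: norm_mult)
        then have "(norm (e x))\<^sup>2 \<le> (\<Sum>k\<in>?S. norm (a k) * 1)\<^sup>2" by (intro power_mono) auto
        also have "\<dots> \<le> (\<Sum>k\<in>?S. (norm (a k))\<^sup>2) * (\<Sum>k\<in>?S. 1\<^sup>2)" by (rule Cauchy_Schwarz_ineq_sum)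
        also have "\<dots> = A\<^sup>2 * real (card ?S)" by (simp add: A2)
        also have "\<dots> \<le> H\<^sup>2" unfolding H2 using C1(2)[OF N1] N by (intro mult_left_mono) auto
        finally show "(norm (e x))\<^sup>2 \<le> H\<^sup>2" .
      qed (use H in simp)
      have level: "measure torus {x \<in> space torus. H / 2 ^ j < norm (e x)} \<le> C4 * N powr (-d) * 2 powr (real j * s)" for j
      proof -
        define m where "m = measure torus {x \<in> space torus. H / 2 ^ j < norm (e x)}"
        have "(H / 2 ^ j)\<^sup>2 * m powr (1 - \<sigma>) \<le> C2 * A\<^sup>2 * N powr (d * \<sigma> - 2)"
          unfolding m_def e A2 using H N N1 by (intro C2(2)) auto
        moreover have "(2 ^ j)\<^sup>2 = (4::real) ^ j"
          by (simp add: power2_eq_square flip: power_mult_distrib)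
        ultimately have "H\<^sup>2 * m powr (1 - \<sigma>) \<le> 4 ^ j * (C2 * A\<^sup>2 * N powr (d * \<sigma> - 2))"
          by (simp add: power_divide divide_le_eq mult.commute)
        then have "A\<^sup>2 * (C1 * N powr (d - 2) * m powr (1 - \<sigma>)) \<le> A\<^sup>2 * (4 ^ j * C2 * N powr (d * \<sigma> - 2))"
          unfolding H2 by (simp add: mult_ac)
        then have "C1 * N powr (d - 2) * m powr (1 - \<sigma>) \<le> 4 ^ j * C2 * N powr (d * \<sigma> - 2)"
          using A by (simp add: mult_le_cancel_left)
        then have "m powr (1 - \<sigma>) \<le> C2 / C1 * 4 ^ j * (N powr (d * \<sigma> - 2) / N powr (d - 2))"
          using C1 N1 by (simp add: field_simps)
        \<comment> \<open>The powers of \<open>N\<close> combine to \<open>N powr (-d)\<close> for every admissible \<open>\<sigma>\<close>: the level sets near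
          the height \<open>H\<close> are, up to a constant, no larger than balls of radius \<open>1/N\<close>.\<close>
        also have "N powr (d * \<sigma> - 2) / N powr (d - 2) = N powr (- d * (1 - \<sigma>))"
          by (simp add: algebra_simps flip: powr_diff)
        also have "(4 :: real) ^ j = 2 powr (2 * real j)"
          by (simp add: powr_powr[symmetric] powr_realpow)
        finally have "(m powr (1 - \<sigma>)) powr (1 / (1 - \<sigma>))
            \<le> (C2 / C1 * 2 powr (2 * real j) * N powr (- d * (1 - \<sigma>))) powr (1 / (1 - \<sigma>))"
          using \<sigma>1 by (intro powr_mono2) auto
        also have "\<dots> = C4 * 2 powr (real j * s) * N powr (-d)"
          using \<sigma>1 by (simp only: powr_mult powr_powr C4_def) (simp add: s_def mult.commute)
        finally show ?thesis using \<sigma>1 by (simp add: m_def powr_powr mult_ac)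
      qed
      interpret finite_measure "torus :: (real ^ 'd) measure" by (rule finite_measure_torus)
      have "(\<integral>x. norm (e x) powr p \<partial>torus) \<le> C3 * (C4 * N powr (-d) * H powr p)"
        unfolding C3_def using C4 H eH level sp p0 em
        by (intro integral_powr_le_of_level_sets) auto
      then have "torus_Lp_norm p e \<le> (C3 * (C4 * N powr (-d) * H powr p)) powr (1 / p)"
        unfolding torus_Lp_norm_def LINT_cube_eq_torus
        using p0 by (intro powr_mono2 integral_nonneg_AE) auto
      also have "\<dots> = (C3 * C4) powr (1 / p) * N powr (- d / p) * H"
        using p0 H by (simp add: powr_mult powr_powr mult_ac)
      also have "\<dots> = (C3 * C4) powr (1 / p) * sqrt C1 * (N powr ((d - 2) / 2) * N powr (- d / p)) * A"
        by (simp add: H_def mult_ac)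
      also have "N powr ((d - 2) / 2) * N powr (- d / p) = N powr ((d - 2) / 2 - d / p)"
        by (simp flip: powr_add)
      finally show ?thesis unfolding L2 d_def .
    qed
  qed
qed

end
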